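(* Let $\Bbbk$ be a field of characteristic zero and let $K=K\{\mathbf f\}$ under the following hypotheses: (a) $\mathbf f=c\prod_{i=1}^m(x+\xi_i)\prod_{j=1}^n(y+\chi_j)$ where $c\in\Bbbk^\times$ and $(\xi_i)_{i=1}^m$, $(\chi_j)_{j=1}^n$ are families of distinct scalars in $\Bbbk$, with $m,n\ge3$. (b) $m\ne n$, or $m=n$ is odd. (c) The families $(\xi_i-\xi_1)_{i=2}^m$ and $(\chi_j-\chi_1)_{j=2}^n$ are each $\mathbb Z$-linearly independent. (d) $(\xi_i-\xi_1)^m\ne(\xi_1-\xi_j)^m$ for all $i\ne j$, and $(\chi_i-\chi_1)^n\ne(\chi_1-\chi_j)^n$ for all $i\ne j$. Then the group $\mathrm{Aut}_{Poi}(K)$ is trivial.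
   Context: For $\mathbf f\in\Bbbk(x,y)$, $K\{\mathbf f\}$ denotes the rational function field $\Bbbk(x,y)$ equipped with the unique ($\Bbbk$-bilinear) Poisson bracket such that $\{x,y\}=\mathbf f$; explicitly $\{g,h\}=\left(\frac{\partial g}{\partial x}\frac{\partial h}{\partial y}-\frac{\partial g}{\partial y}\frac{\partial h}{\partial x}\right)\mathbf f$. $\mathrm{Aut}_{Poi}(K)$ is the group of $\Bbbk$-algebra automorphisms of $K$ preserving the Poisson bracket. *)

theory Defs
  imports
    "HOL-Computational_Algebra.Computational_Algebra"
    "HOL-Algebra.Elementary_Groups"
    "HOL-Algebra.Bij"
begin

text \<open>
  The rational function field \<open>k(x,y)\<close> is the fraction field of \<open>k[x][y]\<close>: the inner polynomial
  layer carries \<open>x\<close>, the outer one carries \<open>y\<close>.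
\<close>

type_synonym 'a ratfun2 = "'a poly poly fract"

definition scal :: "'a::field_char_0 \<Rightarrow> 'a ratfun2" where
  "scal a = to_fract [:[:a:]:]"

definition var_x :: "'a::field_char_0 ratfun2" where
  "var_x = to_fract [:[:0, 1:]:]"

definition var_y :: "'a::field_char_0 ratfun2" where
  "var_y = to_fract [:0, 1:]"


text \<open>
  Extension of a derivation to the fraction field by the quotient rule. For maps \<open>D\<close> that are not
  derivations the description need not denote; \<open>fract_derivation_Fract\<close> gives well-definedness.
\<close>

definition fract_derivation :: "('r::idom \<Rightarrow> 'r) \<Rightarrow> 'r fract \<Rightarrow> 'r fract" where
  "fract_derivation D z =
     (THE w. \<exists>p q. q \<noteq> 0 \<and> z = Fract p q \<and> w = Fract (D p * q - p * D q) (q * q))"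

lemma fract_derivation_Fract:
  fixes D :: "'r::idom \<Rightarrow> 'r"
  assumes D: "\<And>a b. D (a * b) = a * D b + b * D a"
    and b: "b \<noteq> 0"
  shows "fract_derivation D (Fract a b) = Fract (D a * b - a * D b) (b * b)"
proof -
  have "Fract (D c * d - c * D d) (d * d) = Fract (D a * b - a * D b) (b * b)"
    if nz: "d \<noteq> 0" and "Fract a b = Fract c d" for c d
  proof -
    from that b have eq: "a * d = c * b" by (simp add: eq_fract)
    from arg_cong[OF eq, of D] have Deq: "a * D d + d * D a = c * D b + b * D c"
      by (simp add: D)
    have "(D a * b - a * D b) * (d * d) - (D c * d - c * D d) * (b * b)
        = b * d * (d * D a - b * D c) - (a * d) * d * D b + (c * b) * b * D d"
      by (simp add: algebra_simps)
    also have "\<dots> = b * d * (d * D a - b * D c) - (c * b) * d * D b + (a * d) * b * D d"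
      by (simp only: eq)
    also have "\<dots> = b * d * ((a * D d + d * D a) - (c * D b + b * D c))"
      by (simp add: algebra_simps)
    finally show ?thesis using nz b by (simp add: Deq eq_fract)
  qed
  then show ?thesis
    unfolding fract_derivation_def using b by (intro the_equality) blast+
qed

lemma map_poly_pderiv_mult:
  fixes p q :: "'a::field_char_0 poly poly"
  shows "map_poly pderiv (p * q) = p * map_poly pderiv q + q * map_poly pderiv p"
proof (rule poly_eqI)
  fix n
  have pderiv_sum: "pderiv (\<Sum>i\<in>A. g i) = (\<Sum>i\<in>A. pderiv (g i))"
    for A and g :: "nat \<Rightarrow> 'a poly"
    using higher_pderiv_sum[of 1 g A] by simp
  have "poly.coeff (map_poly pderiv (p * q)) n =
      (\<Sum>i\<le>n. poly.coeff p i * pderiv (poly.coeff q (n - i))) +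
      (\<Sum>i\<le>n. pderiv (poly.coeff p i) * poly.coeff q (n - i))"
    by (simp add: coeff_map_poly coeff_mult pderiv_sum pderiv_mult sum.distrib mult.commute)
  also have "\<dots> = poly.coeff (p * map_poly pderiv q + map_poly pderiv p * q) n"
    by (simp add: coeff_mult coeff_map_poly)
  finally show "poly.coeff (map_poly pderiv (p * q)) n =
      poly.coeff (p * map_poly pderiv q + q * map_poly pderiv p) n"
    by (simp add: mult.commute)
qed

definition partial_x :: "'a::field_char_0 ratfun2 \<Rightarrow> 'a ratfun2" where
  "partial_x = fract_derivation (map_poly pderiv)"

definition partial_y :: "'a::field_char_0 ratfun2 \<Rightarrow> 'a ratfun2" where
  "partial_y = fract_derivation pderiv"

lemma partial_x_Fract:
  "q \<noteq> 0 \<Longrightarrow>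
    partial_x (Fract p q) = Fract (map_poly pderiv p * q - p * map_poly pderiv q) (q * q)"
  unfolding partial_x_def by (rule fract_derivation_Fract[OF map_poly_pderiv_mult])

lemma partial_y_Fract:
  "q \<noteq> 0 \<Longrightarrow> partial_y (Fract p q) = Fract (pderiv p * q - p * pderiv q) (q * q)"
  unfolding partial_y_def by (rule fract_derivation_Fract[OF pderiv_mult])

definition poisson_bracket ::
  "'a::field_char_0 ratfun2 \<Rightarrow> 'a ratfun2 \<Rightarrow> 'a ratfun2 \<Rightarrow> 'a ratfun2" where
  "poisson_bracket f g h =
     (partial_x g * partial_y h - partial_y g * partial_x h) * f"

lemma partials_of_vars:
  "partial_x var_x = 1" "partial_y var_x = 0" "partial_x var_y = 0" "partial_y var_y = 1"
  "partial_x (scal a) = 0" "partial_y (scal a) = 0"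
proof -
  have one: "map_poly pderiv (1 :: 'a poly poly) = 0"
    by (simp add: map_poly_1)
  show "partial_x var_x = 1" "partial_y var_x = 0" "partial_x var_y = 0" "partial_y var_y = 1"
    "partial_x (scal a) = 0" "partial_y (scal a) = 0"
    by (simp_all add: var_x_def var_y_def scal_def to_fract_def partial_x_Fract partial_y_Fract
        one map_poly_pCons pderiv_pCons One_fract_def Zero_fract_def eq_fract one_pCons)
qed

lemma poisson_bracket_var_x_var_y: "poisson_bracket f var_x var_y = f"
  by (simp add: poisson_bracket_def partials_of_vars)


definition algebra_automorphism :: "('a::field_char_0 ratfun2 \<Rightarrow> 'a ratfun2) \<Rightarrow> bool" where
  "algebra_automorphism \<phi> \<longleftrightarrow>
     bij \<phi> \<and>
     (\<forall>g h. \<phi> (g + h) = \<phi> g + \<phi> h) \<and>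
     (\<forall>g h. \<phi> (g * h) = \<phi> g * \<phi> h) \<and>
     (\<forall>a. \<phi> (scal a) = scal a)"

definition poisson_automorphisms ::
  "'a::field_char_0 ratfun2 \<Rightarrow> ('a ratfun2 \<Rightarrow> 'a ratfun2) set" where
  "poisson_automorphisms f =
     {\<phi>. algebra_automorphism \<phi> \<and>
         (\<forall>g h. \<phi> (poisson_bracket f g h) = poisson_bracket f (\<phi> g) (\<phi> h))}"

definition Aut_Poi :: "'a::field_char_0 ratfun2 \<Rightarrow> ('a ratfun2 \<Rightarrow> 'a ratfun2) monoid" where
  "Aut_Poi f = BijGroup UNIV \<lparr>carrier := poisson_automorphisms f\<rparr>"

lemma one_Aut_Poi: "\<one>\<^bsub>Aut_Poi f\<^esub> = id"
  by (simp add: Aut_Poi_def BijGroup_def restrict_UNIV id_def)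

lemma mult_Aut_Poi:
  assumes "\<phi> \<in> poisson_automorphisms f" "\<psi> \<in> poisson_automorphisms f"
  shows "\<phi> \<otimes>\<^bsub>Aut_Poi f\<^esub> \<psi> = \<phi> \<circ> \<psi>"
  using assms
  by (auto simp: Aut_Poi_def BijGroup_def Bij_def poisson_automorphisms_def
      algebra_automorphism_def compose_def fun_eq_iff)

lemma group_Aut_Poi: "group (Aut_Poi f)"
proof (rule groupI)
  fix \<phi> \<psi> assume "\<phi> \<in> carrier (Aut_Poi f)" "\<psi> \<in> carrier (Aut_Poi f)"
  then have *: "\<phi> \<in> poisson_automorphisms f" "\<psi> \<in> poisson_automorphisms f"
    by (simp_all add: Aut_Poi_def)
  have "\<phi> \<circ> \<psi> \<in> poisson_automorphisms f"
    using * by (auto simp: poisson_automorphisms_def algebra_automorphism_def intro: bij_comp)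
  then show "\<phi> \<otimes>\<^bsub>Aut_Poi f\<^esub> \<psi> \<in> carrier (Aut_Poi f)"
    by (simp add: mult_Aut_Poi[OF *]) (simp add: Aut_Poi_def)
next
  show "\<one>\<^bsub>Aut_Poi f\<^esub> \<in> carrier (Aut_Poi f)"
    by (simp add: one_Aut_Poi)
       (simp add: Aut_Poi_def poisson_automorphisms_def algebra_automorphism_def)
next
  fix \<phi> \<psi> \<chi>
  assume "\<phi> \<in> carrier (Aut_Poi f)" "\<psi> \<in> carrier (Aut_Poi f)" "\<chi> \<in> carrier (Aut_Poi f)"
  then have *: "\<phi> \<in> poisson_automorphisms f" "\<psi> \<in> poisson_automorphisms f"
    "\<chi> \<in> poisson_automorphisms f"
    by (simp_all add: Aut_Poi_def)
  have "\<phi> \<circ> \<psi> \<in> poisson_automorphisms f" "\<psi> \<circ> \<chi> \<in> poisson_automorphisms f"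
    using * by (auto simp: poisson_automorphisms_def algebra_automorphism_def intro: bij_comp)
  with * show "\<phi> \<otimes>\<^bsub>Aut_Poi f\<^esub> \<psi> \<otimes>\<^bsub>Aut_Poi f\<^esub> \<chi> = \<phi> \<otimes>\<^bsub>Aut_Poi f\<^esub> (\<psi> \<otimes>\<^bsub>Aut_Poi f\<^esub> \<chi>)"
    by (simp add: mult_Aut_Poi comp_assoc)
next
  fix \<phi> assume "\<phi> \<in> carrier (Aut_Poi f)"
  then have *: "\<phi> \<in> poisson_automorphisms f" by (simp add: Aut_Poi_def)
  then show "\<one>\<^bsub>Aut_Poi f\<^esub> \<otimes>\<^bsub>Aut_Poi f\<^esub> \<phi> = \<phi>"
    using mult_Aut_Poi[of id f \<phi>]
    by (simp add: one_Aut_Poi poisson_automorphisms_def algebra_automorphism_def)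
  have bij: "bij \<phi>" using * by (simp add: poisson_automorphisms_def algebra_automorphism_def)
  have inv1: "inv_into UNIV \<phi> (\<phi> g) = g" and inv2: "\<phi> (inv_into UNIV \<phi> g) = g" for g
    using bij by (simp_all add: bij_is_inj bij_is_surj surj_f_inv_f)
  have inv_eq: "inv_into UNIV \<phi> u = v \<longleftrightarrow> u = \<phi> v" for u v
    using inv1 inv2 by metis
  have "inv_into UNIV \<phi> \<in> poisson_automorphisms f"
    using * bij
    by (simp add: poisson_automorphisms_def algebra_automorphism_def inv_eq inv2 bij_imp_bij_inv)
  moreover from this have "inv_into UNIV \<phi> \<otimes>\<^bsub>Aut_Poi f\<^esub> \<phi> = \<one>\<^bsub>Aut_Poi f\<^esub>"
    by (simp add: mult_Aut_Poi * one_Aut_Poi inv1 fun_eq_iff)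
  ultimately show "\<exists>\<psi>\<in>carrier (Aut_Poi f). \<psi> \<otimes>\<^bsub>Aut_Poi f\<^esub> \<phi> = \<one>\<^bsub>Aut_Poi f\<^esub>"
    by (auto simp: Aut_Poi_def)
qed


text \<open>
  Independence of a finite family, counted with repetitions; the library notion is about sets, see
  the lemma below for the comparison.
\<close>

definition int_lin_indep_family :: "('i \<Rightarrow> 'a::field_char_0) \<Rightarrow> 'i set \<Rightarrow> bool" where
  "int_lin_indep_family v I \<longleftrightarrow>
     (\<forall>a :: 'i \<Rightarrow> int. (\<Sum>i\<in>I. of_int (a i) * v i) = 0 \<longrightarrow> (\<forall>i\<in>I. a i = 0))"

lemma int_lin_indep_family_iff:
  fixes v :: "'i \<Rightarrow> 'a::field_char_0"
  assumes "finite I"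
  shows "int_lin_indep_family v I \<longleftrightarrow>
    inj_on v I \<and> \<not> Modules.module.dependent (\<lambda>(a::int) (x::'a). of_int a * x) (v ` I)"
    (is "?L \<longleftrightarrow> ?R")
proof -
  interpret M: Modules.module "\<lambda>(a::int) (x::'a). of_int a * x"
    by standard (simp_all add: algebra_simps)
  show ?thesis
  proof
    assume L: ?L
    have "inj_on v I"
    proof (rule inj_onI, rule ccontr)
      fix i j assume ij: "i \<in> I" "j \<in> I" "v i = v j" "i \<noteq> j"
      define a :: "'i \<Rightarrow> int" where "a k = (if k = i then 1 else if k = j then -1 else 0)" for k
      have "(\<Sum>k\<in>I. of_int (a k) * v k) = (\<Sum>k\<in>{i, j}. of_int (a k) * v k)"
        using assms ij by (intro sum.mono_neutral_right) (auto simp: a_def)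
      also have "\<dots> = 0" using ij by (simp add: a_def)
      finally have "a i = 0" using L ij(1) by (auto simp: int_lin_indep_family_def)
      then show False by (simp add: a_def)
    qed
    moreover have "M.independent (v ` I)"
      using L assms calculation
      by (auto simp: M.dependent_finite int_lin_indep_family_def sum.reindex)
    ultimately show ?R by simp
  next
    assume R: ?R
    show ?L
      unfolding int_lin_indep_family_def
    proof (intro allI impI ballI)
      fix a :: "'i \<Rightarrow> int" and i
      assume s: "(\<Sum>i\<in>I. of_int (a i) * v i) = 0" and i: "i \<in> I"
      define u where "u x = a (inv_into I v x)" for x
      have "(\<Sum>x\<in>v ` I. of_int (u x) * x) = (\<Sum>i\<in>I. of_int (a i) * v i)"
        using R by (simp add: sum.reindex u_def)
      with s R assms i have "u (v i) = 0" by (auto simp: M.dependent_finite)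
      then show "a i = 0" using R i by (simp add: u_def)
    qed
  qed
qed

end

theory Submission
  imports Defs "Berlekamp_Zassenhaus.Unique_Factorization_Poly"
begin

text \<open>
  Call a discrete valuation \<open>\<nu>\<close> of \<open>k(x,y)\<close>, trivial on \<open>k\<close>, a Poisson valuation if
  \<open>\<nu> {a, b} \<ge> \<nu> a + \<nu> b - 1\<close>. Applied to \<open>{x, y + e} = f\<close>, where \<open>f\<close> has degree at least 3 in each
  variable, this bound forces \<open>\<nu> x \<ge> 0\<close> and \<open>\<nu> y \<ge> 0\<close>; conversely every \<open>h\<close>-adic valuation with \<open>h\<close>
  prime in \<open>k[x,y]\<close> is a Poisson valuation. Hence \<open>k[x,y]\<close> is the intersection of the valuation
  rings of all Poisson valuations, and every Poisson automorphism preserves it. There it multiplies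
  \<open>f\<close> by its Jacobian, which is a unit, so it permutes the prime factors \<open>x + \<xi>\<^sub>i\<close>, \<open>y + \<chi>\<^sub>j\<close> up to
  scalars. It is therefore affine in each variable, up to a swap; the hypotheses on \<open>\<xi>\<close> and \<open>\<chi>\<close>
  exclude nontrivial affine permutations, and the sign of the bracket excludes the swap.
\<close>

subsection \<open>Affine permutations of the parameters\<close>

text \<open>An affine permutation of slope \<open>a \<noteq> 1\<close> has a fixed point \<open>\<beta>\<close>, and \<open>\<xi> - \<beta>\<close> sums to zero over every
  invariant set of indices. Two complementary invariant sets would give an integral relation, so the
  permutation is transitive, \<open>a ^ m = 1\<close>, and \<open>a\<close> times the step after index \<open>1\<close> is the step before it,
  against the hypothesis on powers.\<close>

lemma affine_permutation_trivial:
  fixes \<xi> :: "nat \<Rightarrow> 'k::field_char_0"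
  assumes m: "m \<ge> 3"
    and inj: "inj_on \<xi> {1..m}"
    and indep: "int_lin_indep_family (\<lambda>i. \<xi> i - \<xi> 1) {2..m}"
    and pow: "\<forall>i\<in>{1..m}. \<forall>j\<in>{1..m}. i \<noteq> j \<longrightarrow> (\<xi> i - \<xi> 1) ^ m \<noteq> (\<xi> 1 - \<xi> j) ^ m"
    and aff: "\<And>i. i \<in> {1..m} \<Longrightarrow> \<exists>k\<in>{1..m}. a * \<xi> k = \<xi> i + b"
  shows "a = 1 \<and> b = 0"
proof -
  define I where "I = {1..m}"
  have I: "finite I" "card I = m" "1 \<in> I" "2 \<in> I" using m by (auto simp: I_def)
  obtain \<sigma> where \<sigma>: "\<And>i. i \<in> I \<Longrightarrow> \<sigma> i \<in> I" "\<And>i. i \<in> I \<Longrightarrow> a * \<xi> (\<sigma> i) = \<xi> i + b"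
    using aff unfolding I_def by metis
  have inj_eq: "i = j" if "\<xi> i = \<xi> j" "i \<in> I" "j \<in> I" for i j
    using inj that by (auto simp: I_def dest: inj_onD)
  have inj_\<sigma>: "inj_on \<sigma> I"
  proof (rule inj_onI)
    fix i j assume ij: "i \<in> I" "j \<in> I" "\<sigma> i = \<sigma> j"
    then have "\<xi> i + b = \<xi> j + b" using \<sigma>(2)[of i] \<sigma>(2)[of j] by simp
    then show "i = j" using ij inj_eq by simp
  qed
  have bij: "bij_betw \<sigma> I I"
    unfolding bij_betw_def using inj_\<sigma> \<sigma>(1) endo_inj_surj[OF I(1), of \<sigma>] by auto
  have mu: "of_nat m \<noteq> (0::'k)" using m by simp
  show ?thesis
  proof (cases "a = 1")
    case True
    have "(\<Sum>i\<in>I. \<xi> i) = (\<Sum>i\<in>I. \<xi> (\<sigma> i))"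
      using sum.reindex_bij_betw[OF bij, of \<xi>] by simp
    also have "\<dots> = (\<Sum>i\<in>I. \<xi> i + b)" using \<sigma>(2) True by (intro sum.cong) auto
    also have "\<dots> = (\<Sum>i\<in>I. \<xi> i) + of_nat m * b" by (simp add: sum.distrib I)
    finally show ?thesis using mu True by simp
  next
    case False
    define \<beta> where "\<beta> = b / (a - 1)"
    define u where "u i = \<xi> i - \<beta>" for i
    have \<beta>: "a * \<beta> = \<beta> + b" using False by (simp add: \<beta>_def field_simps)
    have u: "a * u (\<sigma> i) = u i" if "i \<in> I" for i
      using \<sigma>(2)[OF that] \<beta> by (simp add: u_def algebra_simps)
    have sum0: "(\<Sum>i\<in>S. u i) = 0" if S: "S \<subseteq> I" "\<sigma> ` S \<subseteq> S" for S
    proof -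
      have "finite S" using S I finite_subset by blast
      moreover have inj_S: "inj_on \<sigma> S" using inj_\<sigma> S inj_on_subset by blast
      ultimately have "\<sigma> ` S = S" using S by (simp add: endo_inj_surj)
      then have "(\<Sum>i\<in>S. u i) = (\<Sum>i\<in>S. u (\<sigma> i))"
        using inj_S sum.reindex[of \<sigma> S u] by simp
      then have "a * (\<Sum>i\<in>S. u i) = (\<Sum>i\<in>S. a * u (\<sigma> i))" by (simp add: sum_distrib_left)
      also have "\<dots> = (\<Sum>i\<in>S. u i)" using u S by (intro sum.cong) auto
      finally have "(a - 1) * (\<Sum>i\<in>S. u i) = 0" by (simp add: algebra_simps)
      then show ?thesis using False by simp
    qed
    have no_invariant: "S = I" if S: "S \<subseteq> I" "\<sigma> ` S \<subseteq> S" "S \<noteq> {}" for S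
    proof (rule ccontr)
      assume "S \<noteq> I"
      \<comment> \<open>These weights sum to zero over \<open>I\<close>, so \<open>u i\<close> may
        be replaced by \<open>u i - u 1 = \<xi> i - \<xi> 1\<close>. As \<open>u\<close> sums to
        zero over \<open>S\<close> and over its complement, the result is an integral relation among
        the differences in which no coefficient vanishes.\<close>
      define r where "r i = (if i \<in> S then int (card (I - S)) else - int (card S))" for i
      have fin: "finite S" using S I finite_subset by blast
      have r0: "r i \<noteq> 0" for i
        using \<open>S \<noteq> I\<close> S fin I by (auto simp: r_def)
      have split_sum: "(\<Sum>i\<in>I. g i) = (\<Sum>i\<in>S. g i) + (\<Sum>i\<in>I - S. g i)" for g :: "nat \<Rightarrow> 'k"
        using S I sum.subset_diff[of S I g] by (simp add: add.commute)
      have "(\<Sum>i\<in>I - S. u i) = 0"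
        using split_sum[of u] sum0[of I] sum0[OF S(1,2)] \<sigma>(1) by auto
      then have ru: "(\<Sum>i\<in>I. of_int (r i) * u i) = 0"
        using split_sum[of "\<lambda>i. of_int (r i) * u i"] sum0[OF S(1,2)]
        by (simp add: r_def flip: sum_distrib_left)
           (simp flip: sum_distrib_left minus_mult_left add: sum_negf)
      have r_sum: "(\<Sum>i\<in>I. of_int (r i)) = (0::'k)"
        using split_sum[of "\<lambda>i. of_int (r i)"] by (simp add: r_def)
      have "(\<Sum>i\<in>{2..m}. of_int (r i) * (\<xi> i - \<xi> 1)) = (\<Sum>i\<in>I. of_int (r i) * (\<xi> i - \<xi> 1))"
      proof (intro sum.mono_neutral_left ballI)
        fix i assume "i \<in> I - {2..m}"
        then have "i = 1" by (auto simp: I_def)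
        then show "of_int (r i) * (\<xi> i - \<xi> 1) = 0" by simp
      qed (use I(1) in \<open>auto simp: I_def\<close>)
      also have "\<dots> = (\<Sum>i\<in>I. of_int (r i) * u i - of_int (r i) * u 1)"
        by (intro sum.cong) (auto simp: u_def algebra_simps)
      also have "\<dots> = 0" using ru r_sum by (simp add: sum_subtractf flip: sum_distrib_right)
      finally have "r 2 = 0" using indep m by (auto simp: int_lin_indep_family_def)
      then show False using r0 by simp
    qed
    have "a \<noteq> 0"
    proof
      assume "a = 0"
      then have "\<xi> 1 + b = \<xi> 2 + b" using \<sigma>(2)[OF I(3)] \<sigma>(2)[OF I(4)] by simp
      then show False using inj_eq[of 1 2] I by simp
    qed
    have "u i \<noteq> 0" if "i \<in> I" for i
    proof
      assume "u i = 0"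
      then have "\<xi> (\<sigma> i) = \<xi> i" using u[OF that] \<open>a \<noteq> 0\<close> by (simp add: u_def)
      then have "\<sigma> i = i" using inj_eq that \<sigma>(1) by blast
      then have "{i} = I" using no_invariant[of "{i}"] that by simp
      then show False using I(3,4) by auto
    qed
    then have "(\<Prod>i\<in>I. u i) \<noteq> 0" using I by simp
    moreover have "(\<Prod>i\<in>I. u i) = a ^ m * (\<Prod>i\<in>I. u i)"
    proof -
      have "(\<Prod>i\<in>I. u i) = (\<Prod>i\<in>I. a * u (\<sigma> i))" using u by (intro prod.cong) auto
      also have "\<dots> = a ^ m * (\<Prod>i\<in>I. u (\<sigma> i))" by (simp add: prod.distrib I)
      also have "(\<Prod>i\<in>I. u (\<sigma> i)) = (\<Prod>i\<in>I. u i)" using prod.reindex_bij_betw[OF bij, of u] by simp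
      finally show ?thesis .
    qed
    ultimately have am: "a ^ m = 1" by simp
    obtain j where j: "j \<in> I" "\<sigma> j = 1" using bij I(3) by (metis bij_betw_iff_bijections)
    have "a * (\<xi> (\<sigma> 1) - \<xi> 1) = \<xi> 1 - \<xi> j"
      using \<sigma>(2)[OF I(3)] \<sigma>(2)[OF j(1)] j(2) by (simp add: algebra_simps)
    then have "(\<xi> (\<sigma> 1) - \<xi> 1) ^ m = (\<xi> 1 - \<xi> j) ^ m"
      using am by (metis mult_1 power_mult_distrib)
    then have "\<sigma> 1 = j" using pow \<sigma>(1)[OF I(3)] j(1) unfolding I_def by blast
    \<comment> \<open>\<open>\<sigma>\<close> sends \<open>j\<close> to 1 and now also 1 to
      \<open>j\<close>, so this set is invariant and must be all of \<open>I\<close>, which is too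
      small.\<close>
    then have "{1, j} = I" using no_invariant[of "{1, j}"] j I by auto
    then have "m \<le> 2" using I(2) card_insert_le_m1[of 2 "{j}" 1] by auto
    then show ?thesis using m by simp
  qed
qed

subsection \<open>Derivations and Poisson valuations\<close>

lemma fract_derivation_add:
  fixes D :: "'r::idom \<Rightarrow> 'r"
  assumes D: "\<And>a b. D (a * b) = a * D b + b * D a" and add: "\<And>a b. D (a + b) = D a + D b"
  shows "fract_derivation D (u + v) = fract_derivation D u + fract_derivation D v"
proof (cases u, cases v)
  fix p q r s assume *: "u = Fract p q" "q \<noteq> 0" "v = Fract r s" "s \<noteq> 0"
  then show ?thesis
    by (simp add: fract_derivation_Fract[OF D] D add eq_fract) (simp add: algebra_simps)
qed

lemma fract_derivation_mult:
  fixes D :: "'r::idom \<Rightarrow> 'r"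
  assumes D: "\<And>a b. D (a * b) = a * D b + b * D a"
  shows "fract_derivation D (u * v) = u * fract_derivation D v + v * fract_derivation D u"
proof (cases u, cases v)
  fix p q r s assume *: "u = Fract p q" "q \<noteq> 0" "v = Fract r s" "s \<noteq> 0"
  then show ?thesis
    by (simp add: fract_derivation_Fract[OF D] D eq_fract) (simp add: algebra_simps)
qed

lemma fract_derivation_to_fract:
  fixes D :: "'r::idom \<Rightarrow> 'r"
  assumes D: "\<And>a b. D (a * b) = a * D b + b * D a"
  shows "fract_derivation D (to_fract a) = to_fract (D a)"
proof -
  have "D 1 = 0" using D[of 1 1] by (metis add_cancel_right_right mult_1)
  then show ?thesis by (simp add: to_fract_def fract_derivation_Fract[OF D])
qed

lemma map_poly_pderiv_add:
  "map_poly pderiv (p + q) = map_poly pderiv p + map_poly pderiv (q :: 'a::field_char_0 poly poly)"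
  by (rule poly_eqI) (simp add: coeff_map_poly pderiv_add)

lemma partial_x_add: "partial_x (u + v) = partial_x u + partial_x v"
  unfolding partial_x_def by (rule fract_derivation_add[OF map_poly_pderiv_mult map_poly_pderiv_add])

lemma partial_y_add: "partial_y (u + v) = partial_y u + partial_y v"
  unfolding partial_y_def by (rule fract_derivation_add[OF pderiv_mult pderiv_add])

lemma partial_x_mult: "partial_x (u * v) = u * partial_x v + v * partial_x u"
  unfolding partial_x_def by (rule fract_derivation_mult[OF map_poly_pderiv_mult])

lemma partial_y_mult: "partial_y (u * v) = u * partial_y v + v * partial_y u"
  unfolding partial_y_def by (rule fract_derivation_mult[OF pderiv_mult])

lemma partial_x_to_fract: "partial_x (to_fract p) = to_fract (map_poly pderiv p)"
  unfolding partial_x_def by (rule fract_derivation_to_fract[OF map_poly_pderiv_mult])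

lemma partial_y_to_fract: "partial_y (to_fract p) = to_fract (pderiv p)"
  unfolding partial_y_def by (rule fract_derivation_to_fract[OF pderiv_mult])

text \<open>The power rule multiplied through by \<open>z\<close>: the same power of
  \<open>z\<close> stands on both sides, which shows that a derivation lowers the exponent by at
  most one, for negative exponents too.\<close>

lemma derivation_power_int:
  fixes D :: "'a::field \<Rightarrow> 'a"
  assumes D: "\<And>u v. D (u * v) = u * D v + v * D u" and z: "z \<noteq> 0"
  shows "z * D (z powi i) = of_int i * z powi i * D z"
proof (induction i rule: int_induct[of _ 0])
  case base
  have "D 1 = 0" using D[of 1 1] by (metis add_cancel_right_right mult_1)
  then show ?case by simp
next
  case (step1 i)
  have "z * D (z powi (i + 1)) = z * D (z powi i * z)" using z by (simp add: power_int_add)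
  also have "\<dots> = z * (z powi i * D z) + z * (z * D (z powi i))" by (simp add: D algebra_simps)
  also have "\<dots> = of_int (i + 1) * z powi (i + 1) * D z"
    using z by (simp add: step1 power_int_add algebra_simps)
  finally show ?case .
next
  case (step2 i)
  have "z powi i = z powi (i - 1) * z" using z by (simp add: power_int_diff)
  then have "z * D (z powi i) = z * (z powi (i - 1) * D z) + z * (z * D (z powi (i - 1)))"
    by (simp add: D algebra_simps)
  then have "z * (z * D (z powi (i - 1))) = z * (of_int (i - 1) * z powi (i - 1) * D z)"
    using z step2 by (simp add: power_int_diff field_simps)
  then show ?case using z by simp
qed

lemma scal_simps [simp]:
  "scal 0 = 0" "scal 1 = 1" "scal (a + b) = scal a + scal b" "scal (a * b) = scal a * scal b"
  "scal (- a) = - scal a" "scal (a - b) = scal a - scal b"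
  by (simp_all add: scal_def flip: one_pCons to_fract_hom.hom_mult to_fract_hom.hom_add
     to_fract_hom.hom_uminus to_fract_hom.hom_minus)

lemma scal_eq_iff [simp]: "scal a = scal b \<longleftrightarrow> a = b"
  by (simp add: scal_def)

lemma scal_eq_0_iff [simp]: "scal a = 0 \<longleftrightarrow> a = 0"
  by (simp add: scal_def)

lemma scal_power [simp]: "scal (a ^ k) = scal a ^ k"
  by (induction k) simp_all

text \<open>Valuations here are the Poisson 1-valuations: a divisorial valuation qualifies iff the two-form
  \<open>dx dy / f\<close> has order at most \<open>0\<close> along it. The value at \<open>0\<close> is junk.\<close>

definition poisson_valuation :: "'a::field_char_0 ratfun2 \<Rightarrow> ('a ratfun2 \<Rightarrow> int) \<Rightarrow> bool" where
  "poisson_valuation f \<nu> \<longleftrightarrow>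
     (\<forall>a b. a \<noteq> 0 \<longrightarrow> b \<noteq> 0 \<longrightarrow> \<nu> (a * b) = \<nu> a + \<nu> b) \<and>
     (\<forall>a b. a \<noteq> 0 \<longrightarrow> b \<noteq> 0 \<longrightarrow> a + b \<noteq> 0 \<longrightarrow> min (\<nu> a) (\<nu> b) \<le> \<nu> (a + b)) \<and>
     (\<forall>c. c \<noteq> 0 \<longrightarrow> \<nu> (scal c) = 0) \<and>
     (\<forall>a b. poisson_bracket f a b \<noteq> 0 \<longrightarrow> \<nu> a + \<nu> b - 1 \<le> \<nu> (poisson_bracket f a b))"

context
  fixes f :: "'a::field_char_0 ratfun2" and \<nu>
  assumes \<nu>: "poisson_valuation f \<nu>"
begin

lemma valuation_mult: "a \<noteq> 0 \<Longrightarrow> b \<noteq> 0 \<Longrightarrow> \<nu> (a * b) = \<nu> a + \<nu> b"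
  and valuation_add: "a \<noteq> 0 \<Longrightarrow> b \<noteq> 0 \<Longrightarrow> a + b \<noteq> 0 \<Longrightarrow> min (\<nu> a) (\<nu> b) \<le> \<nu> (a + b)"
  and valuation_scal: "c \<noteq> 0 \<Longrightarrow> \<nu> (scal c) = 0"
  and valuation_bracket:
    "poisson_bracket f a b \<noteq> 0 \<Longrightarrow> \<nu> a + \<nu> b - 1 \<le> \<nu> (poisson_bracket f a b)"
  using \<nu> by (auto simp: poisson_valuation_def)

lemma valuation_uminus: "\<nu> (- a) = \<nu> a"
proof (cases "a = 0")
  case False
  then show ?thesis using valuation_mult[of "scal (-1)" a] valuation_scal[of "-1"] by simp
qed simp

lemma valuation_add_eq:
  assumes "a \<noteq> 0" "b \<noteq> 0" "\<nu> a < \<nu> b"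
  shows "\<nu> (a + b) = \<nu> a"
proof -
  have "a + b \<noteq> 0" using assms valuation_uminus[of b] by (auto simp: add_eq_0_iff2)
  moreover from this have "min (\<nu> (a + b)) (\<nu> b) \<le> \<nu> a"
    using valuation_add[of "a + b" "- b"] assms by (simp add: valuation_uminus)
  ultimately show ?thesis using valuation_add[of a b] assms by simp
qed

lemma valuation_prod:
  "finite I \<Longrightarrow> (\<And>i. i \<in> I \<Longrightarrow> g i \<noteq> 0) \<Longrightarrow> \<nu> (\<Prod>i\<in>I. g i) = (\<Sum>i\<in>I. \<nu> (g i))"
proof (induction I rule: finite_induct)
  case empty
  then show ?case using valuation_scal[of 1] by simp
next
  case (insert i I)
  then show ?case by (simp add: valuation_mult)
qed

text \<open>The hypothesis says that \<open>u\<close> is not a scalar, which keeps the junk value at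
  0 out of all translates. The three claims treat a pole, a regular element and a zero.\<close>

lemma valuation_add_scal:
  assumes "\<And>e. u + scal e \<noteq> 0"
  shows "\<nu> u < 0 \<Longrightarrow> \<nu> (u + scal e) = \<nu> u"
    and "\<nu> u \<ge> 0 \<Longrightarrow> \<nu> (u + scal e) \<ge> 0"
    and "\<nu> u > 0 \<Longrightarrow> e \<noteq> 0 \<Longrightarrow> \<nu> (u + scal e) = 0"
proof -
  have u: "u \<noteq> 0" using assms[of 0] by simp
  show "\<nu> (u + scal e) = \<nu> u" if "\<nu> u < 0"
    using that u valuation_add_eq[of u "scal e"] valuation_scal[of e] by (cases "e = 0") auto
  show "\<nu> (u + scal e) \<ge> 0" if "\<nu> u \<ge> 0"
    using that u assms[of e] valuation_add[of u "scal e"] valuation_scal[of e] by (cases "e = 0") auto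
  show "\<nu> (u + scal e) = 0" if "\<nu> u > 0" "e \<noteq> 0"
    using that u valuation_add_eq[of "scal e" u] valuation_scal[of e] by (simp add: add.commute)
qed

text \<open>Two distinct translates of \<open>v\<close> differ by a nonzero scalar, so at most one
  of them has positive value. The product therefore has a multiple of \<open>\<nu> v\<close> as its
  value at a pole, else the value of that one factor, else 0. The shift \<open>e\<close> found here
  is the one to insert in the bracket bound, where it absorbs all factors in
  \<open>v\<close>.\<close>

lemma valuation_prod_linear_le:
  fixes \<chi> :: "nat \<Rightarrow> 'a"
  assumes v: "\<And>e. v + scal e \<noteq> 0" and J: "finite J" "J \<noteq> {}" "inj_on \<chi> J"
  shows "\<exists>e. \<nu> (\<Prod>j\<in>J. v + scal (\<chi> j)) \<le> \<nu> (v + scal e)"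
proof -
  have prod: "\<nu> (\<Prod>j\<in>J. v + scal (\<chi> j)) = (\<Sum>j\<in>J. \<nu> (v + scal (\<chi> j)))"
    using J v by (simp add: valuation_prod)
  consider "\<nu> v < 0" | j where "j \<in> J" "\<nu> (v + scal (\<chi> j)) > 0"
    | "\<nu> v \<ge> 0" "\<And>j. j \<in> J \<Longrightarrow> \<nu> (v + scal (\<chi> j)) = 0"
    by (metis linorder_neqE not_le valuation_add_scal(2) v)
  then show ?thesis
  proof cases
    case 1
    then have "(\<Sum>j\<in>J. \<nu> (v + scal (\<chi> j))) = int (card J) * \<nu> v"
      by (simp add: valuation_add_scal(1) v)
    also have "\<dots> \<le> 1 * \<nu> v"
      using 1 J card_gt_0_iff[of J] by (intro mult_right_mono_neg) auto
    finally have "\<nu> (\<Prod>j\<in>J. v + scal (\<chi> j)) \<le> \<nu> (v + scal 0)" using prod by simp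
    then show ?thesis ..
  next
    case 2
    have "\<nu> (v + scal (\<chi> i)) = 0" if "i \<in> J - {j}" for i
    proof -
      have "\<chi> i \<noteq> \<chi> j" using J 2 that by (auto dest: inj_onD)
      moreover have "v + scal (\<chi> j) + scal e \<noteq> 0" for e
        using v[of "\<chi> j + e"] by (simp add: add.assoc)
      ultimately show ?thesis
        using valuation_add_scal(3)[of "v + scal (\<chi> j)" "\<chi> i - \<chi> j"] 2 by simp
    qed
    then have "(\<Sum>i\<in>J. \<nu> (v + scal (\<chi> i))) = \<nu> (v + scal (\<chi> j))"
      using J 2 by (simp add: sum.remove[of J j])
    then show ?thesis using prod by (metis order_refl)
  next
    case 3
    obtain j where "j \<in> J" using J by blast
    with 3 have "\<nu> (\<Prod>j\<in>J. v + scal (\<chi> j)) \<le> \<nu> (v + scal (\<chi> j))" using prod by simp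
    then show ?thesis ..
  qed
qed

text \<open>At a pole of \<open>u\<close> every factor \<open>u + scal (\<xi> i)\<close> has value
  \<open>\<nu> u\<close>, so \<open>\<nu> f \<le> 3 * \<nu> u + \<nu> (v + scal e)\<close> for a
  suitable \<open>e\<close>. The bracket bound then yields \<open>2 * \<nu> u \<ge> -1\<close>,
  impossible for a negative integer. With only two factors, \<open>\<nu> u = -1\<close> would
  survive.\<close>

lemma valuation_nonneg:
  fixes \<xi> \<chi> :: "nat \<Rightarrow> 'a"
  assumes f: "f = scal c * (\<Prod>i\<in>I. u + scal (\<xi> i)) * (\<Prod>j\<in>J. v + scal (\<chi> j))" "f \<noteq> 0"
    and u: "\<And>e. u + scal e \<noteq> 0" and v: "\<And>e. v + scal e \<noteq> 0"
    and I: "card I \<ge> 3" and J: "finite J" "J \<noteq> {}" "inj_on \<chi> J"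
    and bracket: "\<And>e. \<nu> u + \<nu> (v + scal e) - 1 \<le> \<nu> f"
  shows "\<nu> u \<ge> 0"
proof (rule ccontr)
  assume neg: "\<not> \<nu> u \<ge> 0"
  have fin: "finite I" using I card.infinite by fastforce
  obtain e where e: "\<nu> (\<Prod>j\<in>J. v + scal (\<chi> j)) \<le> \<nu> (v + scal e)"
    using valuation_prod_linear_le v J by blast
  have "c \<noteq> 0" using f by auto
  then have "\<nu> f = int (card I) * \<nu> u + \<nu> (\<Prod>j\<in>J. v + scal (\<chi> j))"
    using u v neg fin J
    by (simp add: f(1) valuation_mult valuation_scal valuation_prod valuation_add_scal(1))
  moreover have "int (card I) * \<nu> u \<le> 3 * \<nu> u"
    using I neg by (intro mult_right_mono_neg) auto
  ultimately show False using bracket[of e] e neg by linarith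
qed

end

lemma poisson_bracket_add_scal: "poisson_bracket f g (h + scal e) = poisson_bracket f g h"
  by (simp add: poisson_bracket_def partial_x_add partial_y_add partials_of_vars)

lemma var_add_scal_nonzero: "var_x + scal e \<noteq> 0" "var_y + scal e \<noteq> 0"
  by (simp_all add: var_x_def var_y_def scal_def flip: to_fract_hom.hom_add)

text \<open>The previous bound applies in both orders of the variables: the brackets
  \<open>{x, y + e}\<close> and \<open>{y, x + e}\<close> are \<open>f\<close> and
  \<open>-f\<close>, and a sign does not change the value.\<close>

lemma poisson_valuation_vars_nonneg:
  fixes f :: "'a::field_char_0 ratfun2" and \<xi> \<chi> :: "nat \<Rightarrow> 'a"
  assumes \<nu>: "poisson_valuation f \<nu>"
    and f: "f = scal c * (\<Prod>i\<in>I. var_x + scal (\<xi> i)) * (\<Prod>j\<in>J. var_y + scal (\<chi> j))" "c \<noteq> 0"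
    and I: "card I \<ge> 3" "inj_on \<xi> I" and J: "card J \<ge> 3" "inj_on \<chi> J"
  shows "\<nu> var_x \<ge> 0" "\<nu> var_y \<ge> 0"
proof -
  have fin: "finite I" "finite J" using I J card.infinite by fastforce+
  have f0: "f \<noteq> 0" using f fin by (simp add: var_add_scal_nonzero)
  have xy: "poisson_bracket f var_x (var_y + scal e) = f" for e
    by (simp add: poisson_bracket_add_scal poisson_bracket_var_x_var_y)
  have yx: "poisson_bracket f var_y (var_x + scal e) = - f" for e
    by (simp add: poisson_bracket_add_scal) (simp add: poisson_bracket_def partials_of_vars)
  show "\<nu> var_x \<ge> 0"
  proof (rule valuation_nonneg[OF \<nu> f(1)])
    show "\<nu> var_x + \<nu> (var_y + scal e) - 1 \<le> \<nu> f" for e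
      using valuation_bracket[OF \<nu>, of var_x "var_y + scal e"] f0 by (simp add: xy)
  qed (use f0 I J fin in \<open>auto simp: var_add_scal_nonzero\<close>)
  show "\<nu> var_y \<ge> 0"
  proof (rule valuation_nonneg[OF \<nu>])
    show "f = scal c * (\<Prod>j\<in>J. var_y + scal (\<chi> j)) * (\<Prod>i\<in>I. var_x + scal (\<xi> i))"
      using f by (simp add: ac_simps)
    show "\<nu> var_y + \<nu> (var_x + scal e) - 1 \<le> \<nu> f" for e
      using valuation_bracket[OF \<nu>, of var_y "var_x + scal e"] f0
      by (simp add: yx valuation_uminus[OF \<nu>])
  qed (use f0 I J fin in \<open>auto simp: var_add_scal_nonzero\<close>)
qed

subsection \<open>Prime-adic valuations\<close>

text \<open>For prime \<open>h\<close> this is the localization at the ideal generated by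
  \<open>h\<close>, the valuation ring of the \<open>h\<close>-adic order.\<close>

definition local_ring :: "'r::idom \<Rightarrow> 'r fract set" where
  "local_ring h = {to_fract a / to_fract b | a b. \<not> h dvd b}"

text \<open>For prime \<open>h\<close> and nonzero \<open>g\<close>, existence and uniqueness of the
  exponent are \<open>order_at_exists\<close> and \<open>order_at_le\<close>. At 0 no such
  representation exists, so the value there is unspecified and later statements exclude it.\<close>

definition order_at :: "'r::idom \<Rightarrow> 'r fract \<Rightarrow> int" where
  "order_at h g = (THE i. \<exists>a b. \<not> h dvd a \<and> \<not> h dvd b \<and>
     g = to_fract h powi i * to_fract a / to_fract b)"

context
  fixes h :: "'r::ufd"
  assumes h: "prime_elem h"
begin

lemma prime_not_dvd_mult: "\<not> h dvd a \<Longrightarrow> \<not> h dvd b \<Longrightarrow> \<not> h dvd a * b"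
  using h unfolding prime_elem_def by blast

lemma prime_not_dvd_1: "\<not> h dvd 1"
  using h unfolding prime_elem_def by blast

lemma prime_not_dvd_unit: "u dvd 1 \<Longrightarrow> \<not> h dvd u"
  using prime_not_dvd_1 dvd_trans by blast

lemma prime_nonzero: "h \<noteq> 0"
  using h by (auto simp: prime_elem_def)

text \<open>Induction on a factorization into irreducibles: an irreducible factor divisible by
  \<open>h\<close> is \<open>h\<close> times a unit and raises the exponent by one, while any other
  factor goes into the cofactor.\<close>

lemma prime_power_decomposition:
  assumes "p \<noteq> 0"
  shows "\<exists>k a. p = h ^ k * a \<and> \<not> h dvd a"
proof (cases "p dvd 1")
  case True
  then have "\<not> h dvd p" by (rule prime_not_dvd_unit)
  then show ?thesis by (intro exI[of _ 0] exI[of _ p]) simp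
next
  case False
  then obtain F where F: "\<And>q. q \<in># F \<Longrightarrow> irreducible q" "p = prod_mset F"
    using mset_factors_exist[OF assms] by (auto simp: mset_factors_def)
  from F(1) have "\<exists>k a. prod_mset F = h ^ k * a \<and> \<not> h dvd a"
  proof (induction F)
    case empty
    then show ?case using prime_not_dvd_1 by (intro exI[of _ 0] exI[of _ 1]) simp
  next
    case (add q F)
    then obtain k a where ka: "prod_mset F = h ^ k * a" "\<not> h dvd a" by auto
    show ?case
    proof (cases "h dvd q")
      case True
      then obtain e where e: "q = h * e" by auto
      have "e dvd 1"
        using irreducibleD[of q h e] add.prems[of q] e prime_not_dvd_1 by auto
      then have "\<not> h dvd e * a" using ka prime_not_dvd_mult prime_not_dvd_unit by blast
      then show ?thesis
        using ka e by (intro exI[of _ "Suc k"] exI[of _ "e * a"]) (simp add: ac_simps)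
    next
      case False
      then have "\<not> h dvd q * a" using ka prime_not_dvd_mult by blast
      then show ?thesis
        using ka by (intro exI[of _ k] exI[of _ "q * a"]) (simp add: ac_simps)
    qed
  qed
  then show ?thesis using F(2) by simp
qed

lemma order_at_exists:
  assumes "g \<noteq> 0"
  obtains i a b where "\<not> h dvd a" "\<not> h dvd b" "g = to_fract h powi i * to_fract a / to_fract b"
proof -
  obtain p q where pq: "g = Fract p q" "q \<noteq> 0" "p \<noteq> 0"
    using assms by (cases g rule: Fract_cases_nonzero) auto
  obtain k a where a: "p = h ^ k * a" "\<not> h dvd a" using prime_power_decomposition[OF pq(3)] by blast
  obtain l b where b: "q = h ^ l * b" "\<not> h dvd b" using prime_power_decomposition[OF pq(2)] by blast
  have "g = to_fract p / to_fract q" using pq by (simp add: to_fract_def)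
  also have "\<dots> = to_fract h powi (int k - int l) * to_fract a / to_fract b"
    using a b prime_nonzero by (simp add: power_int_diff to_fract_hom.hom_power)
  finally show ?thesis using that a(2) b(2) by blast
qed

text \<open>If \<open>i\<close> were larger, clearing denominators would make \<open>h\<close>
  divide \<open>c * b\<close>. Used in both directions, this gives uniqueness of the
  exponent.\<close>

lemma order_at_le:
  assumes "\<not> h dvd a" "\<not> h dvd b" "\<not> h dvd c" "\<not> h dvd d"
    and eq: "to_fract h powi i * to_fract a / to_fract b = to_fract h powi j * to_fract c / to_fract d"
  shows "i \<le> j"
proof (rule ccontr)
  assume "\<not> i \<le> j"
  define k where "k = nat (i - j)"
  have k: "i = j + int k" "k > 0" using \<open>\<not> i \<le> j\<close> by (auto simp: k_def)
  have nz: "b \<noteq> 0" "d \<noteq> 0" using assms by auto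
  have "to_fract h powi j * (to_fract h ^ k * to_fract a * to_fract d) = to_fract h powi j * (to_fract c * to_fract b)"
    using eq prime_nonzero nz by (simp add: k power_int_add field_simps)
  then have "to_fract (h ^ k * a * d) = to_fract (c * b)"
    using prime_nonzero by (simp add: to_fract_hom.hom_power)
  then have "h ^ k * a * d = c * b" by (simp only: to_fract_eq_iff)
  then have "h dvd c * b" using k(2) by (metis dvd_mult2 dvd_power dvd_triv_left dvd_trans)
  then show False using assms prime_not_dvd_mult by blast
qed

lemma order_at_eq:
  assumes "\<not> h dvd a" "\<not> h dvd b"
  shows "order_at h (to_fract h powi i * to_fract a / to_fract b) = i"
  unfolding order_at_def
proof (rule the_equality)
  fix j assume "\<exists>c d. \<not> h dvd c \<and> \<not> h dvd d \<and>
    to_fract h powi i * to_fract a / to_fract b = to_fract h powi j * to_fract c / to_fract d"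
  then obtain c d where *: "\<not> h dvd c" "\<not> h dvd d"
    "to_fract h powi i * to_fract a / to_fract b = to_fract h powi j * to_fract c / to_fract d"
    by blast
  show "j = i"
    using order_at_le[OF assms *(1,2,3)] order_at_le[OF *(1,2) assms *(3)[symmetric]] by simp
qed (use assms in blast)

lemma local_ringI: "\<not> h dvd b \<Longrightarrow> to_fract a / to_fract b \<in> local_ring h"
  by (auto simp: local_ring_def)

lemma local_ring_to_fract: "to_fract a \<in> local_ring h"
  using local_ringI[OF prime_not_dvd_1, of a] by simp

lemma local_ring_mult:
  assumes "u \<in> local_ring h" "v \<in> local_ring h"
  shows "u * v \<in> local_ring h"
proof -
  obtain a b c d where *: "u = to_fract a / to_fract b" "\<not> h dvd b"
    "v = to_fract c / to_fract d" "\<not> h dvd d"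
    using assms by (auto simp: local_ring_def)
  then show ?thesis using local_ringI[OF prime_not_dvd_mult[of b d], of "a * c"] by simp
qed

lemma local_ring_uminus: "u \<in> local_ring h \<Longrightarrow> - u \<in> local_ring h"
  using local_ring_mult[of "to_fract (- 1)" u] local_ring_to_fract[of "- 1"]
  by (simp add: to_fract_hom.hom_uminus)

lemma local_ring_add:
  assumes "u \<in> local_ring h" "v \<in> local_ring h"
  shows "u + v \<in> local_ring h"
proof -
  obtain a b c d where *: "u = to_fract a / to_fract b" "\<not> h dvd b"
    "v = to_fract c / to_fract d" "\<not> h dvd d"
    using assms by (auto simp: local_ring_def)
  have "b \<noteq> 0" "d \<noteq> 0" using * by auto
  then have "u + v = to_fract (a * d + c * b) / to_fract (b * d)"
    by (simp add: * add_frac_eq)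
  then show ?thesis
    using local_ringI[OF prime_not_dvd_mult[OF *(2,4)], of "a * d + c * b"] by (simp only:)
qed

lemma local_ring_diff: "u \<in> local_ring h \<Longrightarrow> v \<in> local_ring h \<Longrightarrow> u - v \<in> local_ring h"
  using local_ring_add[of u "- v"] local_ring_uminus by simp

lemma local_ring_of_int: "of_int i \<in> local_ring h"
  using local_ring_to_fract[of "of_int i"] by (simp add: to_fract_hom.hom_of_int)

lemma local_ring_fract_derivation:
  assumes D: "\<And>a b. D (a * b) = a * D b + b * D a" and u: "u \<in> local_ring h"
  shows "fract_derivation D u \<in> local_ring h"
proof -
  obtain a b where *: "u = Fract a b" "\<not> h dvd b"
    using u by (auto simp: local_ring_def to_fract_def)
  then have "b \<noteq> 0" by auto
  then have "fract_derivation D u = to_fract (D a * b - a * D b) / to_fract (b * b)"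
    by (simp add: * fract_derivation_Fract[OF D] to_fract_def)
  then show ?thesis
    using local_ringI[OF prime_not_dvd_mult[OF *(2,2)], of "D a * b - a * D b"] by (simp only:)
qed

text \<open>The device for lower bounds on orders: exhibit a power of \<open>h\<close> times an
  element of the local ring. The latter can only contribute further nonnegative powers of
  \<open>h\<close>.\<close>

lemma order_at_ge:
  assumes "w \<in> local_ring h" "w \<noteq> 0"
  shows "i \<le> order_at h (to_fract h powi i * w)"
proof -
  obtain a b where *: "w = to_fract a / to_fract b" "\<not> h dvd b" "a \<noteq> 0"
    using assms by (auto simp: local_ring_def)
  obtain k c where c: "a = h ^ k * c" "\<not> h dvd c" using prime_power_decomposition[OF *(3)] by blast
  have "to_fract h powi i * w = to_fract h powi (i + int k) * to_fract c / to_fract b"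
    using * c prime_nonzero by (simp add: power_int_add to_fract_hom.hom_power)
  then have "order_at h (to_fract h powi i * w) = i + int k" using * c by (simp only: order_at_eq not_False_eq_True)
  then show ?thesis by simp
qed

lemma order_at_decomposition:
  assumes "g \<noteq> 0"
  obtains w where "w \<in> local_ring h" "w \<noteq> 0" "g = to_fract h powi order_at h g * w"
proof -
  obtain i a b where *: "\<not> h dvd a" "\<not> h dvd b" "g = to_fract h powi i * to_fract a / to_fract b"
    by (rule order_at_exists[OF assms])
  then have "a \<noteq> 0" "b \<noteq> 0" by auto
  moreover have "order_at h g = i" using * order_at_eq by simp
  ultimately show ?thesis
    using that[of "to_fract a / to_fract b"] * local_ringI by simp
qed

lemma order_at_nonneg_imp_local_ring:
  assumes "g \<noteq> 0" "order_at h g \<ge> 0"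
  shows "g \<in> local_ring h"
proof -
  define k where "k = nat (order_at h g)"
  have k: "order_at h g = int k" using assms(2) by (simp add: k_def)
  obtain w where w: "w \<in> local_ring h" "g = to_fract h powi int k * w"
    unfolding k[symmetric] by (rule order_at_decomposition[OF assms(1)])
  have "g = to_fract (h ^ k) * w" using w(2) by (simp add: to_fract_hom.hom_power)
  then show ?thesis using local_ring_mult[OF local_ring_to_fract w(1)] by simp
qed

lemma order_at_mult:
  assumes "g \<noteq> 0" "g' \<noteq> 0"
  shows "order_at h (g * g') = order_at h g + order_at h g'"
proof -
  obtain i a b where *: "\<not> h dvd a" "\<not> h dvd b" "g = to_fract h powi i * to_fract a / to_fract b"
    by (rule order_at_exists[OF assms(1)])
  obtain j c d where **: "\<not> h dvd c" "\<not> h dvd d" "g' = to_fract h powi j * to_fract c / to_fract d"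
    by (rule order_at_exists[OF assms(2)])
  have "g * g' = to_fract h powi (i + j) * to_fract (a * c) / to_fract (b * d)"
    using prime_nonzero by (simp add: * ** power_int_add)
  then have "order_at h (g * g') = i + j"
    using order_at_eq[OF prime_not_dvd_mult[OF *(1) **(1)] prime_not_dvd_mult[OF *(2) **(2)]]
    by (simp only:)
  then show ?thesis using order_at_eq[OF *(1,2)] order_at_eq[OF **(1,2)] by (simp only: *(3) **(3))
qed

text \<open>The smaller power of \<open>h\<close> is factored out of both summands, and the
  remaining sum stays in the local ring.\<close>

lemma order_at_add_left:
  assumes nz: "g \<noteq> 0" "g' \<noteq> 0" "g + g' \<noteq> 0" and le: "order_at h g \<le> order_at h g'"
  shows "order_at h g \<le> order_at h (g + g')"
proof -
  define i k where "i = order_at h g" and "k = nat (order_at h g' - order_at h g)"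
  have k: "order_at h g' = i + int k" using le by (simp add: i_def k_def)
  obtain w where w: "w \<in> local_ring h" "g = to_fract h powi i * w"
    unfolding i_def by (rule order_at_decomposition[OF nz(1)])
  obtain w' where w': "w' \<in> local_ring h" "g' = to_fract h powi (i + int k) * w'"
    unfolding k[symmetric] by (rule order_at_decomposition[OF nz(2)])
  have eq: "g + g' = to_fract h powi i * (w + to_fract (h ^ k) * w')"
    using w(2) w'(2) prime_nonzero
    by (simp add: power_int_add to_fract_hom.hom_power distrib_left mult.assoc)
  have "w + to_fract (h ^ k) * w' \<in> local_ring h"
    using w w' by (intro local_ring_add local_ring_mult local_ring_to_fract)
  moreover have "w + to_fract (h ^ k) * w' \<noteq> 0" using eq nz(3) by (metis mult_zero_right)
  ultimately have "i \<le> order_at h (g + g')" unfolding eq by (rule order_at_ge)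
  then show ?thesis by (simp add: i_def)
qed

lemma order_at_add:
  assumes nz: "g \<noteq> 0" "g' \<noteq> 0" "g + g' \<noteq> 0"
  shows "min (order_at h g) (order_at h g') \<le> order_at h (g + g')"
proof (cases "order_at h g \<le> order_at h g'")
  case True
  then show ?thesis using order_at_add_left[OF nz] by linarith
next
  case False
  then have "order_at h g' \<le> order_at h (g' + g)"
    using nz by (intro order_at_add_left) (auto simp: add.commute)
  then show ?thesis by (simp add: add.commute)
qed

end

text \<open>Prime factors are removed from the denominator one at a time: if \<open>h\<close>
  divides the denominator of \<open>p / q\<close> and also \<open>g = a / b\<close> with
  \<open>h\<close> not dividing \<open>b\<close>, then cross multiplication shows that
  \<open>h\<close> divides \<open>p\<close> and cancels. The numerator changes at each step, so the
  induction is over all \<open>p\<close>.\<close>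

lemma integral_if_in_local_rings:
  fixes g :: "'r::ufd fract"
  assumes "\<And>h. prime_elem h \<Longrightarrow> g \<in> local_ring h"
  shows "g \<in> range to_fract"
proof -
  have *: "g \<in> range to_fract" if "\<And>q. q \<in># F \<Longrightarrow> irreducible q" "g = to_fract p / to_fract (prod_mset F)" for F p
    using that
  proof (induction F arbitrary: p)
    case empty
    then show ?case by simp
  next
    case (add h F)
    have h: "prime_elem h" using add.prems by simp
    then have "h \<noteq> 0" by (auto simp: prime_elem_def)
    have nz: "prod_mset F \<noteq> 0" using add.prems by (auto simp: irreducible_def)
    obtain a b where ab: "g = to_fract a / to_fract b" "\<not> h dvd b"
      using assms[OF h] by (auto simp: local_ring_def)
    have "b \<noteq> 0" using ab by auto
    have "to_fract (p * b) = to_fract (a * (h * prod_mset F))"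
      using ab(1) add.prems(2) \<open>b \<noteq> 0\<close> \<open>h \<noteq> 0\<close> nz by (simp add: field_simps)
    then have "p * b = a * (h * prod_mset F)" by (simp only: to_fract_eq_iff)
    then have "h dvd p * b" by simp
    then have "h dvd p" using prime_not_dvd_mult[OF h _ ab(2)] by blast
    then obtain q where "p = h * q" by auto
    then have "g = to_fract q / to_fract (prod_mset F)" using add.prems(2) \<open>h \<noteq> 0\<close> by simp
    then show ?case using add by auto
  qed
  obtain p q where pq: "g = to_fract p / to_fract q" "q \<noteq> 0"
    by (cases g) (auto simp: to_fract_def)
  show ?thesis
  \<comment> \<open>Only non-units are factored into irreducibles; a unit denominator is inverted
    directly.\<close>
  proof (cases "q dvd 1")
    case True
    then obtain r where r: "1 = q * r" by auto
    then have "to_fract q * to_fract r = 1" by (simp flip: to_fract_hom.hom_mult)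
    then have "inverse (to_fract q) = to_fract r" by (rule inverse_unique)
    then have "g = to_fract (p * r)" using pq by (simp add: divide_inverse)
    then show ?thesis by (simp only: rangeI)
  next
    case False
    then obtain F where "\<And>h. h \<in># F \<Longrightarrow> irreducible h" "q = prod_mset F"
      using mset_factors_exist[OF pq(2)] unfolding mset_factors_def by blast
    then show ?thesis using *[of F p] pq(1) by simp
  qed
qed

text \<open>With \<open>a\<close> and \<open>b\<close> written as powers of \<open>h\<close> times
  \<open>u\<close> and \<open>v\<close> in the local ring, each partial derivative could lose one
  power of \<open>h\<close>. The term losing both is a multiple of the bracket of \<open>h\<close>
  with itself and cancels by antisymmetry, so only one power is lost in total.\<close>

lemma poisson_valuation_order_at:
  fixes h F :: "'a::field_char_0 poly poly"
  assumes h: "prime_elem h"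
  shows "poisson_valuation (to_fract F) (order_at h)"
proof -
  let ?t = "to_fract h"
  have t: "?t \<noteq> 0" using prime_nonzero[OF h] by simp
  have scal0: "order_at h (scal c) = 0" if "c \<noteq> 0" for c
  proof -
    have "[:[:c:]:] * [:[:inverse c:]:] = 1" using that by simp
    then have "[:[:c:]:] dvd 1" by (metis dvd_triv_left)
    then have "\<not> h dvd [:[:c:]:]" by (rule prime_not_dvd_unit[OF h])
    then show ?thesis
      using order_at_eq[OF h _ prime_not_dvd_1[OF h], of "[:[:c:]:]" 0] by (simp add: scal_def)
  qed
  have bracket: "order_at h a + order_at h b - 1 \<le> order_at h (poisson_bracket (to_fract F) a b)"
    if nz: "poisson_bracket (to_fract F) a b \<noteq> 0" for a b
  proof -
    \<comment> \<open>Vanishing of the derivatives at 0 shows that a nonzero bracket has nonzero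
      arguments, as the factorizations below require.\<close>
    have Z: "partial_x 0 = (0 :: 'a ratfun2)" "partial_y 0 = (0 :: 'a ratfun2)"
      using partials_of_vars(5,6)[of 0] by auto
    have "a \<noteq> 0" "b \<noteq> 0" using nz by (auto simp: poisson_bracket_def Z)
    define i j where ij: "i = order_at h a" "j = order_at h b"
    obtain u where u: "u \<in> local_ring h" "a = ?t powi i * u"
      unfolding ij by (rule order_at_decomposition[OF h \<open>a \<noteq> 0\<close>])
    obtain v where v: "v \<in> local_ring h" "b = ?t powi j * v"
      unfolding ij by (rule order_at_decomposition[OF h \<open>b \<noteq> 0\<close>])
    have deriv: "?t * D (?t powi i * u) = ?t powi i * (?t * D u + of_int i * (u * D ?t))"
      if D: "\<And>u v. D (u * v) = u * D v + v * D u" for D :: "'a ratfun2 \<Rightarrow> 'a ratfun2" and i u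
      using derivation_power_int[OF D t, of i] by (simp add: D algebra_simps)
    \<comment> \<open>\<open>w\<close> is what remains of the bracket after extracting
      \<open>?t powi (i + j - 1)\<close>; the product with both coefficients \<open>i\<close> and
      \<open>j\<close> has cancelled. All its constituents visibly lie in the local ring.\<close>
    define w where "w = (?t * (partial_x u * partial_y v - partial_y u * partial_x v)
        + of_int j * (v * (partial_x u * partial_y ?t - partial_y u * partial_x ?t))
        + of_int i * (u * (partial_x ?t * partial_y v - partial_y ?t * partial_x v))) * to_fract F"
    have "?t * ?t * poisson_bracket (to_fract F) a b =
      (?t * partial_x a * (?t * partial_y b) - ?t * partial_y a * (?t * partial_x b)) * to_fract F"
      by (simp add: poisson_bracket_def algebra_simps)
    also have "\<dots> = ?t powi i * ?t powi j * ?t * w"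
      unfolding u(2) v(2) deriv[OF partial_x_mult] deriv[OF partial_y_mult] w_def
      by (simp add: algebra_simps)
    finally have "?t * (?t * poisson_bracket (to_fract F) a b) = ?t * (?t powi i * ?t powi j * w)"
      by (simp add: ac_simps)
    then have "?t * poisson_bracket (to_fract F) a b = ?t powi i * ?t powi j * w"
      using t by (simp only: mult_cancel_left) simp
    then have "poisson_bracket (to_fract F) a b = ?t powi (i + j - 1) * w"
      using t by (simp add: power_int_add power_int_diff field_simps)
    moreover have "w \<in> local_ring h"
      unfolding w_def using u(1) v(1)
      by (intro local_ring_mult local_ring_add local_ring_diff local_ring_to_fract
          local_ring_of_int h local_ring_fract_derivation map_poly_pderiv_mult pderiv_mult
          local_ring_fract_derivation[OF h map_poly_pderiv_mult, folded partial_x_def]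
          local_ring_fract_derivation[OF h pderiv_mult, folded partial_y_def])
    ultimately show ?thesis using order_at_ge[OF h] nz ij by auto
  qed
  show ?thesis
    unfolding poisson_valuation_def
    using order_at_mult[OF h] order_at_add[OF h] scal0 bracket by blast
qed

subsection \<open>Poisson automorphisms\<close>

text \<open>Scalars and the two variables generate the polynomial ring. Behaviour of an automorphism
  on polynomials is thus decided on these generators.\<close>

lemma to_fract_poly_poly_induct [case_names scal var_x var_y add mult]:
  fixes p :: "'a::field_char_0 poly poly"
  assumes scal: "\<And>a. P (scal a)" and x: "P var_x" and y: "P var_y"
    and add: "\<And>u v. P u \<Longrightarrow> P v \<Longrightarrow> P (u + v)"
    and mult: "\<And>u v. P u \<Longrightarrow> P v \<Longrightarrow> P (u * v)"
  shows "P (to_fract p)"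
proof -
  have const: "P (to_fract [:q:])" for q :: "'a poly"
  proof (induction q)
    case 0
    then show ?case using scal[of 0] by simp
  next
    case (pCons a q)
    have "[:pCons a q:] = [:[:a:]:] + [:[:0, 1:]:] * [:q:]" by simp
    then have "to_fract [:pCons a q:] = scal a + var_x * to_fract [:q:]"
      unfolding scal_def var_x_def by (simp only: to_fract_hom.hom_add to_fract_hom.hom_mult)
    then show ?case using add[OF scal mult[OF x pCons.IH]] by simp
  qed
  show ?thesis
  proof (induction p)
    case 0
    then show ?case using scal[of 0] by simp
  next
    case (pCons q p)
    have "pCons q p = [:q:] + [:0, 1:] * p" by simp
    then have "to_fract (pCons q p) = to_fract [:q:] + var_y * to_fract p"
      unfolding var_y_def by (simp only: to_fract_hom.hom_add to_fract_hom.hom_mult)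
    then show ?case using add[OF const mult[OF y pCons.IH]] by simp
  qed
qed

section \<open>Linear polynomials, units and primes in the polynomial ring\<close>

lemma var_x_add_scal: "var_x + scal e = to_fract [:[:e, 1:]:]"
  and var_y_add_scal: "var_y + scal e = to_fract [:[:e:], 1:]"
  by (simp_all add: var_x_def var_y_def scal_def flip: to_fract_hom.hom_add)

text \<open>Differentiation isolates the slope; the constant term follows by cancellation.\<close>

lemma affine_eq_imp:
  assumes "scal a * var_x + scal b = scal a' * var_x + scal b'
    \<or> scal a * var_y + scal b = scal a' * var_y + scal b'"
  shows "a = a' \<and> b = b'"
proof -
  from assms have "a = a'"
  proof
    assume "scal a * var_x + scal b = scal a' * var_x + scal b'"
    from arg_cong[OF this, of partial_x] show ?thesis
      by (simp add: partial_x_add partial_x_mult partials_of_vars)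
  next
    assume "scal a * var_y + scal b = scal a' * var_y + scal b'"
    from arg_cong[OF this, of partial_y] show ?thesis
      by (simp add: partial_y_add partial_y_mult partials_of_vars)
  qed
  then show ?thesis using assms by auto
qed

lemma affine_x_noteq_affine_y:
  assumes "a \<noteq> 0 \<or> a' \<noteq> 0"
  shows "scal a * var_x + scal b \<noteq> scal a' * var_y + scal b'"
proof
  assume eq: "scal a * var_x + scal b = scal a' * var_y + scal b'"
  have "scal a = 0"
    using arg_cong[OF eq, of partial_x] by (simp add: partial_x_add partial_x_mult partials_of_vars)
  moreover have "scal a' = 0"
    using arg_cong[OF eq, of partial_y] by (simp add: partial_y_add partial_y_mult partials_of_vars)
  ultimately show False using assms by simp
qed

lemma is_unit_poly_poly:
  fixes u :: "'a::field poly poly"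
  assumes "u dvd 1"
  obtains e where "e \<noteq> 0" "u = [:[:e:]:]"
proof -
  obtain q where q: "u = [:q:]" "q dvd 1" using assms by (auto simp: is_unit_poly_iff)
  obtain e where e: "q = [:e:]" "e dvd 1" using q(2) unfolding is_unit_poly_iff[of q] by blast
  then have "e \<noteq> 0" by (metis dvd_0_left zero_neq_one)
  then show ?thesis using that e(1) q(1) by simp
qed

text \<open>\<open>x + e\<close> is constant in the outer variable, so primality is lifted from
  one-variable polynomials over the field.\<close>

lemma prime_elem_linear_x: "prime_elem [:[:e, 1:]:]" for e :: "'a::field"
  by (intro lift_prime_elem_poly prime_elem_linear_field_poly) simp

text \<open>Divisibility by a monic linear polynomial means vanishing at \<open>- e\<close>, and
  evaluation takes values in a domain. This covers \<open>y + e\<close>, whose coefficients are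
  polynomials in \<open>x\<close>.\<close>

lemma prime_elem_monic_linear: "prime_elem [:e, 1:]" for e :: "'a::idom"
proof (rule prime_elemI)
  have dvd: "[:e, 1:] dvd p \<longleftrightarrow> poly p (- e) = 0" for p
    by (simp only: poly_eq_0_iff_dvd minus_minus)
  show "\<not> [:e, 1:] dvd 1" unfolding dvd by simp
  show "[:e, 1:] dvd p \<or> [:e, 1:] dvd q" if "[:e, 1:] dvd p * q" for p q
    using that unfolding dvd by simp
qed simp

lemma prime_dvd_prodE:
  assumes "prime_elem (h::'r::ufd)" "finite I" "h dvd (\<Prod>i\<in>I. g i)"
  obtains i where "i \<in> I" "h dvd g i"
proof -
  have "\<exists>i\<in>I. h dvd g i"
    using assms(2,3)
  proof (induction I rule: finite_induct)
    case empty
    then show ?case using prime_not_dvd_1[OF assms(1)] by simp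
  next
    case (insert i I)
    then show ?case using prime_not_dvd_mult[OF assms(1), of "g i" "\<Prod>i\<in>I. g i"] by auto
  qed
  then show ?thesis using that by blast
qed

section \<open>Transport of structure along a Poisson automorphism\<close>

context
  fixes f :: "'a::field_char_0 ratfun2" and \<phi>
  assumes \<phi>: "\<phi> \<in> poisson_automorphisms f"
begin

lemma automorphism_add: "\<phi> (g + h) = \<phi> g + \<phi> h"
  and automorphism_mult: "\<phi> (g * h) = \<phi> g * \<phi> h"
  and automorphism_scal: "\<phi> (scal a) = scal a"
  and automorphism_bracket: "\<phi> (poisson_bracket f g h) = poisson_bracket f (\<phi> g) (\<phi> h)"
  and automorphism_inj: "inj \<phi>"
  using \<phi> by (auto simp: poisson_automorphisms_def algebra_automorphism_def bij_is_inj)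

text \<open>As \<open>{x, y} = f\<close>, the image of \<open>f\<close> is \<open>f\<close> times
  the Jacobian determinant of the images of the variables.\<close>

lemma automorphism_bracket_vars: "\<phi> f = poisson_bracket f (\<phi> var_x) (\<phi> var_y)"
  by (simp add: poisson_bracket_var_x_var_y flip: automorphism_bracket)

lemma automorphism_0: "\<phi> 0 = 0" and automorphism_1: "\<phi> 1 = 1"
  using automorphism_scal[of 0] automorphism_scal[of 1] by simp_all

lemma automorphism_eq_0_iff: "\<phi> g = 0 \<longleftrightarrow> g = 0"
  using injD[OF automorphism_inj, of g 0] automorphism_0 by auto

lemma automorphism_prod: "\<phi> (\<Prod>i\<in>I. g i) = (\<Prod>i\<in>I. \<phi> (g i))"
  by (induction I rule: infinite_finite_induct) (simp_all add: automorphism_1 automorphism_mult)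

lemma automorphism_divide: "\<phi> (g / h) = \<phi> g / \<phi> h"
proof (cases "h = 0")
  case False
  then show ?thesis
    using automorphism_mult[of "g / h" h] by (simp add: automorphism_eq_0_iff eq_divide_eq)
qed (simp add: automorphism_0)

text \<open>Every clause of the definition speaks of field operations, scalars and the bracket only,
  and all of these commute with \<open>\<phi>\<close>.\<close>

lemma poisson_valuation_comp:
  assumes "poisson_valuation f \<nu>"
  shows "poisson_valuation f (\<nu> \<circ> \<phi>)"
  unfolding poisson_valuation_def comp_apply
proof (intro conjI allI impI)
  fix a b :: "'a ratfun2"
  assume nz: "a \<noteq> 0" "b \<noteq> 0"
  show "\<nu> (\<phi> (a * b)) = \<nu> (\<phi> a) + \<nu> (\<phi> b)"
    unfolding automorphism_mult using nz
    by (intro valuation_mult[OF assms]) (simp_all add: automorphism_eq_0_iff)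
  assume "a + b \<noteq> 0"
  then have "\<phi> a + \<phi> b \<noteq> 0" unfolding automorphism_add[symmetric] automorphism_eq_0_iff .
  then show "min (\<nu> (\<phi> a)) (\<nu> (\<phi> b)) \<le> \<nu> (\<phi> (a + b))"
    unfolding automorphism_add using nz
    by (intro valuation_add[OF assms]) (simp_all add: automorphism_eq_0_iff)
next
  fix c :: 'a
  assume "c \<noteq> 0"
  then show "\<nu> (\<phi> (scal c)) = 0" unfolding automorphism_scal by (rule valuation_scal[OF assms])
next
  fix a b
  assume "poisson_bracket f a b \<noteq> 0"
  then have "poisson_bracket f (\<phi> a) (\<phi> b) \<noteq> 0"
    unfolding automorphism_bracket[symmetric] automorphism_eq_0_iff .
  then show "\<nu> (\<phi> a) + \<nu> (\<phi> b) - 1 \<le> \<nu> (\<phi> (poisson_bracket f a b))"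
    unfolding automorphism_bracket by (rule valuation_bracket[OF assms])
qed

lemma automorphism_eq_id:
  assumes "\<phi> var_x = var_x" "\<phi> var_y = var_y"
  shows "\<phi> = id"
proof
  fix g :: "'a ratfun2"
  have *: "\<phi> (to_fract p) = to_fract p" for p
    by (induction rule: to_fract_poly_poly_induct)
      (simp_all add: assms automorphism_scal automorphism_add automorphism_mult)
  obtain p q where "g = to_fract p / to_fract q" by (cases g) (auto simp: to_fract_def)
  then show "\<phi> g = id g" by (simp add: automorphism_divide *)
qed

text \<open>The inverse is taken in the group \<open>Aut_Poi f\<close>, so it is again a Poisson
  automorphism and everything proved for \<open>\<phi>\<close> applies to it.\<close>

lemma automorphism_inverse:
  "\<exists>\<psi>\<in>poisson_automorphisms f. (\<forall>g. \<psi> (\<phi> g) = g) \<and> (\<forall>g. \<phi> (\<psi> g) = g)"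
proof -
  interpret group "Aut_Poi f" by (rule group_Aut_Poi)
  have carrier: "carrier (Aut_Poi f) = poisson_automorphisms f" by (simp add: Aut_Poi_def)
  define \<psi> where "\<psi> = inv\<^bsub>Aut_Poi f\<^esub> \<phi>"
  have \<psi>: "\<psi> \<in> poisson_automorphisms f" using inv_closed[of \<phi>] \<phi> by (simp add: carrier \<psi>_def)
  have "\<psi> \<circ> \<phi> = id" "\<phi> \<circ> \<psi> = id"
    using l_inv[of \<phi>] r_inv[of \<phi>] mult_Aut_Poi[OF \<psi> \<phi>] mult_Aut_Poi[OF \<phi> \<psi>] \<phi>
    by (simp_all add: carrier one_Aut_Poi \<psi>_def)
  then show ?thesis using \<psi> by (auto simp: fun_eq_iff)
qed

end

section \<open>Rigidity when \<open>f\<close> is a product of linear factors in each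
  variable\<close>

locale product_poisson_field =
  fixes f :: "'a::field_char_0 ratfun2" and c :: 'a and \<xi> \<chi> :: "nat \<Rightarrow> 'a" and I J :: "nat set"
  assumes f: "f = scal c * (\<Prod>i\<in>I. var_x + scal (\<xi> i)) * (\<Prod>j\<in>J. var_y + scal (\<chi> j))"
    and c: "c \<noteq> 0"
    and I: "card I \<ge> 3" "inj_on \<xi> I"
    and J: "card J \<ge> 3" "inj_on \<chi> J"
begin

text \<open>\<open>f\<close> as a polynomial, so that its prime divisors can be discussed;
  divisibility carries no information in the fraction field.\<close>

definition F where
  "F = [:[:c:]:] * (\<Prod>i\<in>I. [:[:\<xi> i, 1:]:]) * (\<Prod>j\<in>J. [:[:\<chi> j:], 1:])"

lemma f_eq: "f = to_fract F"
  unfolding f F_def var_x_add_scal var_y_add_scal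
  by (simp only: scal_def to_fract_hom.hom_mult to_fract_hom.hom_prod)

text \<open>\<open>card\<close> of an infinite set is 0, so the cardinality bounds force
  finiteness.\<close>

lemma finite_indices: "finite I" "finite J"
  using I J card.infinite by fastforce+

lemma f_nonzero: "f \<noteq> 0"
  using c finite_indices by (simp add: f var_add_scal_nonzero)

text \<open>For each prime \<open>h\<close> the composite \<open>order_at h \<circ> \<phi>\<close>
  is again a Poisson valuation, hence nonnegative on both variables. Their images therefore lie in
  all local rings, that is, in the polynomial ring.\<close>

lemma automorphism_integral:
  assumes \<phi>: "\<phi> \<in> poisson_automorphisms f"
  shows "\<phi> (to_fract p) \<in> range to_fract"
proof -
  have "\<phi> var_x \<in> range to_fract \<and> \<phi> var_y \<in> range to_fract"
  proof (intro conjI integral_if_in_local_rings)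
    fix h :: "'a poly poly" assume h: "prime_elem h"
    have "poisson_valuation f (order_at h \<circ> \<phi>)"
      using poisson_valuation_comp[OF \<phi>] poisson_valuation_order_at[OF h] f_eq by metis
    note nonneg = poisson_valuation_vars_nonneg[OF this f c I J]
    \<comment> \<open>A nonnegative order says nothing about 0, where \<open>order_at\<close> is
      unspecified.\<close>
    have "\<phi> var_x \<noteq> 0" "\<phi> var_y \<noteq> 0"
      using automorphism_eq_0_iff[OF \<phi>] var_add_scal_nonzero[of 0] by auto
    then show "\<phi> var_x \<in> local_ring h" "\<phi> var_y \<in> local_ring h"
      using nonneg order_at_nonneg_imp_local_ring[OF h] by auto
  qed
  then obtain p q where pq: "\<phi> var_x = to_fract p" "\<phi> var_y = to_fract q" by blast
  show ?thesis
  proof (induction rule: to_fract_poly_poly_induct)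
    case (scal a)
    show ?case unfolding automorphism_scal[OF \<phi>] by (simp add: scal_def)
  next
    case (add u v)
    then obtain p' q' where "\<phi> u = to_fract p'" "\<phi> v = to_fract q'" by blast
    then have "\<phi> (u + v) = to_fract (p' + q')" by (simp add: automorphism_add[OF \<phi>])
    then show ?case by (simp only: rangeI)
  next
    case (mult u v)
    then obtain p' q' where "\<phi> u = to_fract p'" "\<phi> v = to_fract q'" by blast
    then have "\<phi> (u * v) = to_fract (p' * q')" by (simp add: automorphism_mult[OF \<phi>])
    then show ?case by (simp only: rangeI)
  qed (simp_all add: pq)
qed

lemma automorphism_integralE:
  assumes "\<phi> \<in> poisson_automorphisms f"
  obtains q where "\<phi> (to_fract p) = to_fract q"
  using automorphism_integral[OF assms, of p] by blast

lemma automorphism_f_multiple: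
  assumes \<phi>: "\<phi> \<in> poisson_automorphisms f"
  obtains P where "\<phi> f = to_fract P * f"
proof -
  obtain p where p: "\<phi> var_x = to_fract p"
    unfolding var_x_def by (rule automorphism_integralE[OF \<phi>])
  obtain q where q: "\<phi> var_y = to_fract q"
    unfolding var_y_def by (rule automorphism_integralE[OF \<phi>])
  have "\<phi> f = poisson_bracket f (\<phi> var_x) (\<phi> var_y)"
    by (rule automorphism_bracket_vars[OF \<phi>])
  also have "\<dots> = to_fract (map_poly pderiv p * pderiv q - pderiv p * map_poly pderiv q) * f"
    by (simp add: p q poisson_bracket_def partial_x_to_fract partial_y_to_fract)
  finally show ?thesis by (rule that)
qed

text \<open>Applying \<open>\<phi>\<close> to \<open>\<psi> f = to_fract Q * f\<close> for the
  inverse \<open>\<psi>\<close> exhibits a polynomial inverse of the Jacobian \<open>P\<close>, and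
  the units of the polynomial ring are the nonzero scalars.\<close>

lemma automorphism_f_scal_multiple:
  assumes \<phi>: "\<phi> \<in> poisson_automorphisms f"
  obtains a where "a \<noteq> 0" "\<phi> f = scal a * f"
proof -
  obtain \<psi> where \<psi>: "\<psi> \<in> poisson_automorphisms f" "\<And>g. \<phi> (\<psi> g) = g"
    using automorphism_inverse[OF \<phi>] by blast
  obtain P where P: "\<phi> f = to_fract P * f" by (rule automorphism_f_multiple[OF \<phi>])
  obtain Q where Q: "\<psi> f = to_fract Q * f" by (rule automorphism_f_multiple[OF \<psi>(1)])
  obtain R where R: "\<phi> (to_fract Q) = to_fract R" by (rule automorphism_integralE[OF \<phi>])
  have "f = \<phi> (to_fract Q * f)" using \<psi>(2)[of f] Q by simp
  then have "1 * f = (to_fract R * to_fract P) * f"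
    by (simp add: automorphism_mult[OF \<phi>] P R mult.assoc)
  then have "to_fract 1 = to_fract (P * R)" using f_nonzero
    by (simp only: mult_cancel_right to_fract_hom.hom_mult to_fract_hom.hom_one) (simp add: mult.commute)
  then have "P * R = 1" by (simp only: to_fract_eq_iff)
  then have "P dvd 1" by (metis dvd_triv_left)
  then obtain a where "a \<noteq> 0" "P = [:[:a:]:]" by (rule is_unit_poly_poly)
  then show ?thesis using that P by (simp add: scal_def)
qed

lemma automorphism_unit:
  assumes \<phi>: "\<phi> \<in> poisson_automorphisms f" and u: "\<phi> (to_fract p) = to_fract u" and p: "p dvd 1"
  shows "u dvd 1"
proof -
  obtain e where e: "e \<noteq> 0" "p = [:[:e:]:]" using p by (rule is_unit_poly_poly)
  then have "to_fract u = to_fract p" using u automorphism_scal[OF \<phi>, of e] by (simp add: scal_def)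
  then show ?thesis using p by simp
qed

text \<open>\<open>\<phi>\<close> and its inverse both preserve the polynomial ring. Primality is
  checked as irreducibility, which suffices in a factorial ring: a factorization of \<open>q\<close>
  is pulled back to one of \<open>p\<close>.\<close>

lemma automorphism_prime:
  assumes \<phi>: "\<phi> \<in> poisson_automorphisms f" and p: "prime_elem p" and q: "\<phi> (to_fract p) = to_fract q"
  shows "prime_elem q"
proof -
  obtain \<psi> where \<psi>: "\<psi> \<in> poisson_automorphisms f" "\<And>g. \<psi> (\<phi> g) = g" "\<And>g. \<phi> (\<psi> g) = g"
    using automorphism_inverse[OF \<phi>] by blast
  have \<psi>q: "\<psi> (to_fract q) = to_fract p" using \<psi>(2)[of "to_fract p"] q by simp
  have "irreducible q"
  proof (rule irreducibleI)
    show "q \<noteq> 0"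
    proof
      assume "q = 0"
      then have "to_fract p = 0" using q automorphism_eq_0_iff[OF \<phi>, of "to_fract p"] by simp
      then show False using prime_nonzero[OF p] by simp
    qed
    show "\<not> q dvd 1"
      using automorphism_unit[OF \<psi>(1) \<psi>q] prime_not_dvd_1[OF p] by blast
    fix a b assume ab: "q = a * b"
    obtain a' where a': "\<psi> (to_fract a) = to_fract a'" by (rule automorphism_integralE[OF \<psi>(1)])
    obtain b' where b': "\<psi> (to_fract b) = to_fract b'" by (rule automorphism_integralE[OF \<psi>(1)])
    have "to_fract p = to_fract (a' * b')"
      using \<psi>q a' b' automorphism_mult[OF \<psi>(1), of "to_fract a" "to_fract b"]
      by (simp add: ab)
    then have "p = a' * b'" by (simp only: to_fract_eq_iff)
    moreover have "irreducible p" using p by simp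
    ultimately have "a' dvd 1 \<or> b' dvd 1" by (auto dest: irreducibleD)
    then show "a dvd 1 \<or> b dvd 1"
      using automorphism_unit[OF \<phi>, of a' a] automorphism_unit[OF \<phi>, of b' b] \<psi>(3) a' b'
      by metis
  qed
  then show ?thesis by simp
qed

text \<open>The prime \<open>q\<close> cannot divide the unit factor of \<open>F\<close>, so it
  divides one of the linear primes. It is then associated to it, and the unit relating them is a
  scalar.\<close>

lemma prime_factor_cases:
  assumes q: "prime_elem q" "q dvd F"
  obtains a i where "a \<noteq> 0" "i \<in> I" "to_fract q = scal a * (var_x + scal (\<xi> i))"
    | a j where "a \<noteq> 0" "j \<in> J" "to_fract q = scal a * (var_y + scal (\<chi> j))"
proof -
  have assoc: "\<exists>a. a \<noteq> 0 \<and> to_fract q = scal a * to_fract L" if L: "prime_elem L" "q dvd L" for L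
  proof -
    obtain s where s: "L = q * s" using L(2) by auto
    moreover have "irreducible L" using L(1) by simp
    ultimately have "s dvd 1" using prime_not_dvd_1[OF q(1)] by (auto dest: irreducibleD)
    then obtain e where e: "e \<noteq> 0" "s = [:[:e:]:]" by (rule is_unit_poly_poly)
    have "scal (inverse e) * scal e = 1" using e(1) by (metis scal_simps(2,4) left_inverse)
    moreover have "to_fract L = scal e * to_fract q"
      unfolding s e(2) scal_def by (simp only: to_fract_hom.hom_mult mult.commute)
    ultimately have "to_fract q = scal (inverse e) * to_fract L" by (simp flip: mult.assoc)
    then show ?thesis using e(1) by (intro exI[of _ "inverse e"]) simp
  qed
  have "\<not> q dvd [:[:c:]:]" using c prime_not_dvd_unit[OF q(1)] by (simp add: is_unit_poly_iff)
  then consider "q dvd (\<Prod>i\<in>I. [:[:\<xi> i, 1:]:])" | "q dvd (\<Prod>j\<in>J. [:[:\<chi> j:], 1:])"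
    using q(2) prime_not_dvd_mult[OF q(1)] unfolding F_def by meson
  then show ?thesis
  proof cases
    case 1
    then obtain i where "i \<in> I" "q dvd [:[:\<xi> i, 1:]:]" by (rule prime_dvd_prodE[OF q(1) finite_indices(1)])
    then show ?thesis using assoc[OF prime_elem_linear_x] that(1) by (metis var_x_add_scal)
  next
    case 2
    then obtain j where "j \<in> J" "q dvd [:[:\<chi> j:], 1:]" by (rule prime_dvd_prodE[OF q(1) finite_indices(2)])
    then show ?thesis using assoc[OF prime_elem_monic_linear] that(2) by (metis var_y_add_scal)
  qed
qed

text \<open>Since \<open>\<phi> f\<close> is a scalar multiple of \<open>f\<close>, the image of a
  prime divisor of \<open>F\<close> is a prime dividing \<open>F\<close>.\<close>

lemma automorphism_prime_factor_cases:
  assumes \<phi>: "\<phi> \<in> poisson_automorphisms f" and p: "prime_elem p" "p dvd F"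
  obtains a i where "a \<noteq> 0" "i \<in> I" "\<phi> (to_fract p) = scal a * (var_x + scal (\<xi> i))"
    | a j where "a \<noteq> 0" "j \<in> J" "\<phi> (to_fract p) = scal a * (var_y + scal (\<chi> j))"
proof -
  obtain q where q: "\<phi> (to_fract p) = to_fract q" by (rule automorphism_integralE[OF \<phi>])
  have prime: "prime_elem q" by (rule automorphism_prime[OF \<phi> p(1) q])
  obtain r where r: "F = p * r" using p(2) by auto
  obtain s where s: "\<phi> (to_fract r) = to_fract s" by (rule automorphism_integralE[OF \<phi>])
  obtain a where a: "a \<noteq> 0" "\<phi> f = scal a * f" by (rule automorphism_f_scal_multiple[OF \<phi>])
  have "to_fract ([:[:a:]:] * F) = \<phi> f"
    unfolding a(2) by (simp only: f_eq scal_def to_fract_hom.hom_mult)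
  also have "\<dots> = to_fract (q * s)"
    by (simp only: f_eq r to_fract_hom.hom_mult automorphism_mult[OF \<phi>] q s)
  finally have "to_fract ([:[:a:]:] * F) = to_fract (q * s)" .
  then have "[:[:a:]:] * F = q * s" by (simp only: to_fract_eq_iff)
  then have "q dvd [:[:a:]:] * F" by simp
  moreover have "\<not> q dvd [:[:a:]:]" using a prime_not_dvd_unit[OF prime] by (simp add: is_unit_poly_iff)
  ultimately have "q dvd F" using prime_not_dvd_mult[OF prime] by blast
  then show ?thesis using prime_factor_cases[OF prime] that q by metis
qed

text \<open>A single linear factor \<open>z + scal (\<zeta> k)\<close> already determines
  \<open>\<phi> z\<close> as an affine expression in one variable. The images of the other factors
  differ from it by scalars, so they have the same slope and variable, and comparing constant terms
  matches the parameters. Keeping \<open>z\<close> general serves both variables.\<close>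

lemma automorphism_affine:
  assumes \<phi>: "\<phi> \<in> poisson_automorphisms f"
    and K: "K \<noteq> {}" "\<And>k. k \<in> K \<Longrightarrow> \<exists>p. prime_elem p \<and> p dvd F \<and> z + scal (\<zeta> k) = to_fract p"
  obtains a b where "a \<noteq> 0" "\<phi> z = scal a * var_x + scal b" "\<And>k. k \<in> K \<Longrightarrow> \<exists>i\<in>I. a * \<xi> i = \<zeta> k + b"
    | a b where "a \<noteq> 0" "\<phi> z = scal a * var_y + scal b" "\<And>k. k \<in> K \<Longrightarrow> \<exists>j\<in>J. a * \<chi> j = \<zeta> k + b"
proof -
  have image: "(\<exists>a i. a \<noteq> 0 \<and> i \<in> I \<and> \<phi> z + scal (\<zeta> k) = scal a * var_x + scal (a * \<xi> i)) \<or>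
    (\<exists>a j. a \<noteq> 0 \<and> j \<in> J \<and> \<phi> z + scal (\<zeta> k) = scal a * var_y + scal (a * \<chi> j))" if k: "k \<in> K" for k
  proof -
    obtain p where p: "prime_elem p" "p dvd F" "z + scal (\<zeta> k) = to_fract p"
      using K(2)[OF k] by (elim exE conjE)
    have "\<phi> z + scal (\<zeta> k) = \<phi> (to_fract p)"
      unfolding p(3)[symmetric] automorphism_add[OF \<phi>] automorphism_scal[OF \<phi>] by (rule refl)
    moreover from \<phi> p(1,2) have "(\<exists>a i. a \<noteq> 0 \<and> i \<in> I \<and> \<phi> (to_fract p) = scal a * (var_x + scal (\<xi> i))) \<or>
      (\<exists>a j. a \<noteq> 0 \<and> j \<in> J \<and> \<phi> (to_fract p) = scal a * (var_y + scal (\<chi> j)))"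
      by (rule automorphism_prime_factor_cases) blast+
    ultimately show ?thesis by (simp only: distrib_left scal_simps(4))
  qed
  \<comment> \<open>The factor with index \<open>k0\<close> fixes the target variable, the slope
    \<open>a\<close> and the constant \<open>b\<close>; all other indices are compared with
    it.\<close>
  obtain k0 where k0: "k0 \<in> K" using K(1) by blast
  from image[OF k0] show ?thesis
  proof (elim disjE exE conjE)
    fix a i assume a: "a \<noteq> 0" and i: "\<phi> z + scal (\<zeta> k0) = scal a * var_x + scal (a * \<xi> i)"
    define b where "b = a * \<xi> i - \<zeta> k0"
    have z: "\<phi> z = scal a * var_x + scal b" using i by (simp add: b_def algebra_simps)
    have "\<exists>i\<in>I. a * \<xi> i = \<zeta> k + b" if k: "k \<in> K" for k
    proof -
      have zk: "\<phi> z + scal (\<zeta> k) = scal a * var_x + scal (\<zeta> k + b)" by (simp add: z algebra_simps)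
      from image[OF k, unfolded zk] show ?thesis
      proof (elim disjE exE conjE)
        fix a' l assume l: "l \<in> I"
          and "scal a * var_x + scal (\<zeta> k + b) = scal a' * var_x + scal (a' * \<xi> l)"
        then have "a = a' \<and> \<zeta> k + b = a' * \<xi> l" by (intro affine_eq_imp disjI1)
        then show ?thesis using l by auto
      next
        fix a' l assume "scal a * var_x + scal (\<zeta> k + b) = scal a' * var_y + scal (a' * \<chi> l)"
        then show ?thesis using affine_x_noteq_affine_y[OF disjI1[OF a]] by (metis (no_types))
      qed
    qed
    then show ?thesis using that(1) a z by blast
  next
    fix a i assume a: "a \<noteq> 0" and i: "\<phi> z + scal (\<zeta> k0) = scal a * var_y + scal (a * \<chi> i)"
    define b where "b = a * \<chi> i - \<zeta> k0"
    have z: "\<phi> z = scal a * var_y + scal b" using i by (simp add: b_def algebra_simps)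
    have "\<exists>j\<in>J. a * \<chi> j = \<zeta> k + b" if k: "k \<in> K" for k
    proof -
      have zk: "\<phi> z + scal (\<zeta> k) = scal a * var_y + scal (\<zeta> k + b)" by (simp add: z algebra_simps)
      from image[OF k, unfolded zk] show ?thesis
      proof (elim disjE exE conjE)
        fix a' l assume "scal a * var_y + scal (\<zeta> k + b) = scal a' * var_x + scal (a' * \<xi> l)"
        then show ?thesis using affine_x_noteq_affine_y[OF disjI2[OF a]] by (metis (no_types))
      next
        fix a' l assume l: "l \<in> J"
          and "scal a * var_y + scal (\<zeta> k + b) = scal a' * var_y + scal (a' * \<chi> l)"
        then have "a = a' \<and> \<zeta> k + b = a' * \<chi> l" by (intro affine_eq_imp disjI2)
        then show ?thesis using l by auto
      qed
    qed
    then show ?thesis using that(2) a z by blast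
  qed
qed

lemma linear_factor_x: "i \<in> I \<Longrightarrow> \<exists>p. prime_elem p \<and> p dvd F \<and> var_x + scal (\<xi> i) = to_fract p"
  unfolding F_def var_x_add_scal
  by (intro exI[of _ "[:[:\<xi> i, 1:]:]"] conjI prime_elem_linear_x dvd_mult dvd_mult2
      dvd_prodI[OF finite_indices(1)] refl)

lemma linear_factor_y: "j \<in> J \<Longrightarrow> \<exists>p. prime_elem p \<and> p dvd F \<and> var_y + scal (\<chi> j) = to_fract p"
  unfolding F_def var_y_add_scal
  by (intro exI[of _ "[:[:\<chi> j:], 1:]"] conjI prime_elem_monic_linear dvd_mult
      dvd_prodI[OF finite_indices(2)] refl)

text \<open>The bracket gives \<open>\<phi> f = - a a' f\<close>, the product formula \<open>\<phi> f = (a a') ^ m f\<close>.\<close>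

lemma automorphism_no_swap:
  assumes \<phi>: "\<phi> \<in> poisson_automorphisms f"
    and x: "\<phi> var_x = scal a * var_y + scal b" "\<And>i. i \<in> I \<Longrightarrow> \<exists>j\<in>J. a * \<chi> j = \<xi> i + b"
    and y: "\<phi> var_y = scal a' * var_x + scal b'" "\<And>j. j \<in> J \<Longrightarrow> \<exists>i\<in>I. a' * \<xi> i = \<chi> j + b'"
    and aa': "a * a' = 1"
  shows False
proof -
  obtain \<sigma> where \<sigma>: "\<And>i. i \<in> I \<Longrightarrow> \<sigma> i \<in> J" "\<And>i. i \<in> I \<Longrightarrow> a * \<chi> (\<sigma> i) = \<xi> i + b"
    using x(2) by metis
  obtain \<tau> where \<tau>: "\<And>j. j \<in> J \<Longrightarrow> \<tau> j \<in> I" "\<And>j. j \<in> J \<Longrightarrow> a' * \<xi> (\<tau> j) = \<chi> j + b'"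
    using y(2) by metis
  have inj: "inj_on \<sigma> I" "inj_on \<tau> J"
    using \<sigma>(2) \<tau>(2) I(2) J(2) by (metis (no_types, lifting) add_right_cancel inj_on_def)+
  have card: "card I = card J"
    using card_inj_on_le[OF inj(1) _ finite_indices(2)] card_inj_on_le[OF inj(2) _ finite_indices(1)] \<sigma>(1) \<tau>(1)
    by (simp add: image_subset_iff le_antisym)
  have bij: "bij_betw \<sigma> I J" "bij_betw \<tau> J I"
    using inj \<sigma>(1) \<tau>(1) card finite_indices card_subset_eq[of J "\<sigma> ` I"] card_subset_eq[of I "\<tau> ` J"]
    by (simp_all add: bij_betw_def image_subset_iff card_image)
  have "\<phi> f = scal c * (\<Prod>i\<in>I. \<phi> (var_x + scal (\<xi> i))) * (\<Prod>j\<in>J. \<phi> (var_y + scal (\<chi> j)))"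
    by (subst f) (simp only: automorphism_mult[OF \<phi>] automorphism_prod[OF \<phi>] automorphism_scal[OF \<phi>])
  also have "(\<Prod>i\<in>I. \<phi> (var_x + scal (\<xi> i))) = (\<Prod>i\<in>I. scal a * (var_y + scal (\<chi> (\<sigma> i))))"
    using \<sigma>(2) by (intro prod.cong)
      (simp_all add: automorphism_add[OF \<phi>] automorphism_scal[OF \<phi>] x(1) distrib_left add.assoc
        add.commute flip: scal_simps(3,4))
  also have "\<dots> = scal (a ^ card J) * (\<Prod>j\<in>J. var_y + scal (\<chi> j))"
    using prod.reindex_bij_betw[OF bij(1), of "\<lambda>j. var_y + scal (\<chi> j)"] card by (simp add: prod.distrib)
  also have "(\<Prod>j\<in>J. \<phi> (var_y + scal (\<chi> j))) = (\<Prod>j\<in>J. scal a' * (var_x + scal (\<xi> (\<tau> j))))"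
    using \<tau>(2) by (intro prod.cong)
      (simp_all add: automorphism_add[OF \<phi>] automorphism_scal[OF \<phi>] y(1) distrib_left add.assoc
        add.commute flip: scal_simps(3,4))
  also have "\<dots> = scal (a' ^ card J) * (\<Prod>i\<in>I. var_x + scal (\<xi> i))"
    using prod.reindex_bij_betw[OF bij(2), of "\<lambda>i. var_x + scal (\<xi> i)"] by (simp add: prod.distrib)
  finally have "\<phi> f = scal ((a * a') ^ card J) * f"
    by (simp add: f power_mult_distrib ac_simps)
  then have "\<phi> f = f" by (simp add: aa')
  moreover have "\<phi> f = - (scal (a * a') * f)"
    unfolding automorphism_bracket_vars[OF \<phi>] poisson_bracket_def x(1) y(1)
    by (simp add: partial_x_add partial_x_mult partial_y_add partial_y_mult partials_of_vars)
  ultimately have "f + f = 0" by (simp add: aa')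
  then have "scal (1 + 1) * f = 0"
    by (simp only: scal_simps(2,3) distrib_right mult_1_left)
  then show False using f_nonzero by (simp only: mult_eq_0_iff scal_eq_0_iff) simp
qed

end

theorem corollary7p7:
  fixes f :: "'k::field_char_0 ratfun2"
    and c :: 'k
    and \<xi> \<chi> :: "nat \<Rightarrow> 'k"
    and m n :: nat
  assumes "m \<ge> 3" and "n \<ge> 3"
    and "c \<noteq> 0"
    and "inj_on \<xi> {1..m}" and "inj_on \<chi> {1..n}"
    and "f = scal c * (\<Prod>i=1..m. var_x + scal (\<xi> i)) * (\<Prod>j=1..n. var_y + scal (\<chi> j))"
    and "m \<noteq> n \<or> (m = n \<and> odd m)"
    and "int_lin_indep_family (\<lambda>i. \<xi> i - \<xi> 1) {2..m}"
    and "int_lin_indep_family (\<lambda>j. \<chi> j - \<chi> 1) {2..n}"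
    and "\<forall>i\<in>{1..m}. \<forall>j\<in>{1..m}. i \<noteq> j \<longrightarrow> (\<xi> i - \<xi> 1) ^ m \<noteq> (\<xi> 1 - \<xi> j) ^ m"
    and "\<forall>i\<in>{1..n}. \<forall>j\<in>{1..n}. i \<noteq> j \<longrightarrow> (\<chi> i - \<chi> 1) ^ n \<noteq> (\<chi> 1 - \<chi> j) ^ n"
  shows "trivial_group (Aut_Poi f)"
proof -
  interpret product_poisson_field f c \<xi> \<chi> "{1..m}" "{1..n}"
    by unfold_locales (use assms in simp_all)
  note affine_\<xi> = affine_permutation_trivial[OF assms(1,4,8,10)]
  note affine_\<chi> = affine_permutation_trivial[OF assms(2,5,9,11)]
  have "\<phi> = id" if \<phi>: "\<phi> \<in> poisson_automorphisms f" for \<phi>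
  proof -
    \<comment> \<open>This excludes the cases in which both variables are sent to affine expressions
      in the same variable, where the Jacobian vanishes.\<close>
    have nz: "poisson_bracket f (\<phi> var_x) (\<phi> var_y) \<noteq> 0"
      using automorphism_eq_0_iff[OF \<phi>] f_nonzero by (simp flip: automorphism_bracket_vars[OF \<phi>])
    have ne: "{1..m} \<noteq> {}" "{1..n} \<noteq> {}" using assms(1,2) by auto
    show ?thesis
    proof (rule automorphism_affine[OF \<phi> ne(1) linear_factor_x]; (assumption)?)
      fix a b assume x: "\<phi> var_x = scal a * var_x + scal b"
        "\<And>k. k \<in> {1..m} \<Longrightarrow> \<exists>i\<in>{1..m}. a * \<xi> i = \<xi> k + b"
      show ?thesis
      proof (rule automorphism_affine[OF \<phi> ne(2) linear_factor_y]; (assumption)?)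
        fix a' b' assume "\<phi> var_y = scal a' * var_x + scal b'"
        then show ?thesis using nz x(1)
          by (simp add: poisson_bracket_def partial_x_add partial_x_mult partial_y_add partial_y_mult
              partials_of_vars)
      next
        fix a' b' assume y: "\<phi> var_y = scal a' * var_y + scal b'"
          "\<And>k. k \<in> {1..n} \<Longrightarrow> \<exists>j\<in>{1..n}. a' * \<chi> j = \<chi> k + b'"
        have "a = 1 \<and> b = 0" "a' = 1 \<and> b' = 0" using affine_\<xi> affine_\<chi> x(2) y(2) by blast+
        then show ?thesis using automorphism_eq_id[OF \<phi>] x(1) y(1) by simp
      qed
    next
      fix a b assume x: "\<phi> var_x = scal a * var_y + scal b"
        "\<And>k. k \<in> {1..m} \<Longrightarrow> \<exists>j\<in>{1..n}. a * \<chi> j = \<xi> k + b"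
      show ?thesis
      proof (rule automorphism_affine[OF \<phi> ne(2) linear_factor_y]; (assumption)?)
        fix a' b' assume y: "\<phi> var_y = scal a' * var_x + scal b'"
          "\<And>k. k \<in> {1..n} \<Longrightarrow> \<exists>i\<in>{1..m}. a' * \<xi> i = \<chi> k + b'"
        \<comment> \<open>In the swap case the square of \<open>\<phi>\<close> sends
          \<open>x\<close> to an affine expression in \<open>x\<close> with slope
          \<open>a * a'\<close>. The two matchings of parameters compose to an affine permutation of
          the \<open>\<xi>\<close>, whose triviality forces \<open>a * a' = 1\<close>.\<close>
        have "\<exists>l\<in>{1..m}. a * a' * \<xi> l = \<xi> k + (b + a * b')" if k: "k \<in> {1..m}" for k
        proof -
          obtain j where j: "j \<in> {1..n}" "a * \<chi> j = \<xi> k + b" using x(2)[OF k] by blast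
          obtain l where l: "l \<in> {1..m}" "a' * \<xi> l = \<chi> j + b'" using y(2)[OF j(1)] by blast
          have "a * a' * \<xi> l = a * (\<chi> j + b')" using l(2) by (simp add: mult.assoc)
          also have "\<dots> = \<xi> k + (b + a * b')" using j(2) by (simp add: distrib_left)
          finally show ?thesis using l(1) by blast
        qed
        then have "a * a' = 1" using affine_\<xi> by blast
        then show ?thesis using automorphism_no_swap[OF \<phi> x y] by blast
      next
        fix a' b' assume "\<phi> var_y = scal a' * var_y + scal b'"
        then show ?thesis using nz x(1)
          by (simp add: poisson_bracket_def partial_x_add partial_x_mult partial_y_add partial_y_mult
              partials_of_vars)
      qed
    qed
  qed
  moreover have "id \<in> poisson_automorphisms f"
    by (simp add: poisson_automorphisms_def algebra_automorphism_def)
  ultimately have "poisson_automorphisms f = {id}" by blast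
  then show ?thesis
    using group_Aut_Poi[of f] by (simp add: trivial_group_def one_Aut_Poi) (simp add: Aut_Poi_def)
qed

end
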